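(* The price of anarchy of the $\eta$-noisy Bayesian persuasion game with $k$ selection (for any $1\le k\le N$) is at most $$(11+5\sqrt5)\cdot\Bigl(\frac{1+\eta}{1-\eta}\Bigr)^2;$$ that is, for every Nash equilibrium $\boldsymbol\pi_*=(\pi_1,\dots,\pi_N)\in S_1\times\cdots\times S_N$, $\mathrm{SW}^{\max}\le(11+5\sqrt5)\bigl(\frac{1+\eta}{1-\eta}\bigr)^2\,\mathrm{SW}(\boldsymbol\pi_* )$.
   Context: The $\eta$-noisy Bayesian persuasion game. Let $1\le k\le N$ be integers, $0<\underline v<1$, $0<\eta<1$, and $I_v=I_m=I=[\underline v,1]$. Agent $i\in[N]$ has a prior $\mathcal F_i$, a probability distribution on $I$. The strategy space $S_i$ of agent $i$ is the set of probability measures $\pi_i$ on $I_v\times I_m$ (value, message) such that (a) the marginal of $\pi_i$ on $I_v$ is $\mathcal F_i$; (b) for every continuous function $h$ on $I_m$, $\int(v-m)h(m)\,d\pi_i(v,m)=0$ (i.e. $\mathbb E[v_i\mid m_i]=m_i$ almost surely). Given $(\pi_1,\dots,\pi_N)$, the pairs $(v_i,m_i)\sim\pi_i$ are drawn independently, and independent noises $\xi_i\sim\mathrm{Uniform}[1-\eta,1+\eta]$ are drawn. The principal observes $y_i=m_i\xi_i$ and selects the $k$ agents with the highest $y_i$, breaking ties uniformly at random; $\rho_i(\boldsymbol m,\boldsymbol\xi)$ is the resulting probability that $i$ is selected. Agent $i$ receives $u_i(v_i)$ if selected and $0$ otherwise, where $u_i:I\to\mathbb R_{\ge0}$ is continuous,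 weakly increasing and positive. Expected utility: $U_i(\boldsymbol\pi)=\mathbb E[\rho_i(\boldsymbol m,\boldsymbol\xi)u_i(v_i)]$. A profile is a Nash equilibrium if no agent $i$ can increase $U_i$ by changing only $\pi_i$ within $S_i$. The social welfare $\mathrm{SW}(\boldsymbol\pi)=\mathbb E[\sum_i\rho_i(\boldsymbol m,\boldsymbol\xi)\,m_i]$ is the expected sum of (posterior mean) values of the agents actually selected under noisy observation; the first-best welfare is $\mathrm{SW}^{\max}=\mathbb E[\max_{S\subseteq[N],|S|=k}\sum_{i\in S}v_i]$ with $v_i\sim\mathcal F_i$ independent. The price of anarchy is $\mathrm{SW}^{\max}/\inf\mathrm{SW}(\boldsymbol\pi_* )$, the infimum over Nash equilibria. *)

theory Defs
  imports "HOL-Probability.Probability"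
begin

text \<open>
  Agents are the naturals below \<open>N\<close>; \<open>a\<close> is the lower end of the interval \<open>I = [a, 1]\<close> of values
  and messages. A profile is a function from agents to measures, of which only the entries below
  \<open>N\<close> matter.
\<close>

definition value_space :: "real \<Rightarrow> real measure" where
  "value_space a = restrict_space borel {a..1}"

definition strategies :: "real \<Rightarrow> real measure \<Rightarrow> (real \<times> real) measure set" where
  "strategies a P = {\<pi> \<in> space (prob_algebra (value_space a \<Otimes>\<^sub>M value_space a)).
     distr \<pi> (value_space a) fst = P \<and>
     (\<forall>h :: real \<Rightarrow> real. continuous_on {a..1} h \<longrightarrow> (\<integral>(v, m). (v - m) * h m \<partial>\<pi>) = 0)}"

definition noise :: "real \<Rightarrow> real measure" where
  "noise \<eta> = uniform_measure lborel {1 - \<eta>..1 + \<eta>}"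

definition outcome_space ::
    "nat \<Rightarrow> real \<Rightarrow> (nat \<Rightarrow> (real \<times> real) measure) \<Rightarrow> ((nat \<Rightarrow> real \<times> real) \<times> (nat \<Rightarrow> real)) measure" where
  "outcome_space N \<eta> \<pi> = PiM {..<N} \<pi> \<Otimes>\<^sub>M PiM {..<N} (\<lambda>_. noise \<eta>)"

definition top_sets :: "nat \<Rightarrow> nat \<Rightarrow> (nat \<Rightarrow> real) \<Rightarrow> nat set set" where
  "top_sets N k y = {S. S \<subseteq> {..<N} \<and> card S = k \<and> (\<forall>i\<in>S. \<forall>j\<in>{..<N} - S. y j \<le> y i)}"

text \<open>
  Two members of \<^term>\<open>top_sets N k y\<close> differ only in which agents tied at the cut-off value are
  taken, so uniform tie-breaking is a uniformly random choice from this set (which is nonempty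
  for \<open>k \<le> N\<close>).
\<close>

definition selection_prob :: "nat \<Rightarrow> nat \<Rightarrow> (nat \<Rightarrow> real) \<Rightarrow> (nat \<Rightarrow> real) \<Rightarrow> nat \<Rightarrow> real" where
  "selection_prob N k m \<xi> i =
     measure_pmf.prob (pmf_of_set (top_sets N k (\<lambda>j. m j * \<xi> j))) {S. i \<in> S}"

definition utility ::
    "nat \<Rightarrow> nat \<Rightarrow> real \<Rightarrow> (nat \<Rightarrow> real \<Rightarrow> real) \<Rightarrow> (nat \<Rightarrow> (real \<times> real) measure) \<Rightarrow> nat \<Rightarrow> real" where
  "utility N k \<eta> u \<pi> i =
     (\<integral>(p, \<xi>). selection_prob N k (\<lambda>j. snd (p j)) \<xi> i * u i (fst (p i)) \<partial>outcome_space N \<eta> \<pi>)"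

definition nash_equilibrium ::
    "nat \<Rightarrow> nat \<Rightarrow> real \<Rightarrow> real \<Rightarrow> (nat \<Rightarrow> real measure) \<Rightarrow> (nat \<Rightarrow> real \<Rightarrow> real) \<Rightarrow>
     (nat \<Rightarrow> (real \<times> real) measure) \<Rightarrow> bool" where
  "nash_equilibrium N k a \<eta> F u \<pi> \<longleftrightarrow>
     (\<forall>i<N. \<pi> i \<in> strategies a (F i)) \<and>
     (\<forall>i<N. \<forall>\<pi>'\<in>strategies a (F i). utility N k \<eta> u (\<pi>(i := \<pi>')) i \<le> utility N k \<eta> u \<pi> i)"

definition social_welfare :: "nat \<Rightarrow> nat \<Rightarrow> real \<Rightarrow> (nat \<Rightarrow> (real \<times> real) measure) \<Rightarrow> real" where
  "social_welfare N k \<eta> \<pi> =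
     (\<integral>(p, \<xi>). (\<Sum>i<N. selection_prob N k (\<lambda>j. snd (p j)) \<xi> i * snd (p i)) \<partial>outcome_space N \<eta> \<pi>)"

definition first_best_welfare :: "nat \<Rightarrow> nat \<Rightarrow> (nat \<Rightarrow> real measure) \<Rightarrow> real" where
  "first_best_welfare N k F =
     (\<integral>v. Max ((\<lambda>S. \<Sum>i\<in>S. v i) ` {S. S \<subseteq> {..<N} \<and> card S = k}) \<partial>PiM {..<N} F)"

text \<open>
  Extended reals make the infimum meaningful for every set of equilibria (it would be \<open>\<infinity>\<close> for the
  empty set).
\<close>

definition price_of_anarchy ::
    "nat \<Rightarrow> nat \<Rightarrow> real \<Rightarrow> real \<Rightarrow> (nat \<Rightarrow> real measure) \<Rightarrow> (nat \<Rightarrow> real \<Rightarrow> real) \<Rightarrow> ereal" where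
  "price_of_anarchy N k a \<eta> F u =
     ereal (first_best_welfare N k F) /
     (INF \<pi>\<in>{\<pi>. nash_equilibrium N k a \<eta> F u \<pi>}. ereal (social_welfare N k \<eta> \<pi>))"

end

theory Submission
  imports Defs
begin

text \<open>
  Write \<open>c = (1 + \<eta>) / (1 - \<eta>)\<close>, let \<open>W\<close> be the welfare of an equilibrium and \<open>s = 2 c W / k\<close>.

  If agent \<open>i\<close> is rejected when sending \<open>s\<close>, then \<open>k\<close> other agents have observed values of at
  least \<open>s (1 - \<eta>)\<close>, so the agents selected in equilibrium have total value at least \<open>k s / c\<close>.
  Hence \<open>i\<close> wins with the message \<open>s\<close> with probability at least \<open>1/2\<close>.

  Let \<open>i\<close> deviate as follows: keep the messages that are at least \<open>s\<close>; of the values whose message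
  was below \<open>s\<close>, pool the highest ones to a posterior mean of exactly \<open>s\<close> and reveal the others. On
  the event that the old message is below \<open>s\<close>, the old winning probability is at most that of \<open>s\<close>,
  and the pooled set is an upper set of values; so, for any increasing utility, the deviation is
  unprofitable only if the old winning probability on this event is at least that of the pooled set.
  This bounds \<open>E[max 0 (v - s)]\<close> by twice \<open>i\<close>'s contribution to \<open>W\<close> plus \<open>2 s\<close> times \<open>i\<close>'s winning
  probability. The first-best welfare is at most \<open>k s\<close> plus the sum of these excesses, hence at
  most \<open>k s + 2 (W + s k) \<le> 8 c W\<close>.
\<close>

subsection \<open>Uniform selection of the top agents\<close>

lemma finite_top_sets: "finite (top_sets N k y)"
  by (rule finite_subset[of _ "Pow {..<N}"]) (auto simp: top_sets_def)

lemma top_setsD: "S \<in> top_sets N k y \<Longrightarrow> i \<in> S \<Longrightarrow> j < N \<Longrightarrow> j \<notin> S \<Longrightarrow> y j \<le> y i"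
  by (simp add: top_sets_def)

text \<open>Greedy construction: a maximiser of \<open>y\<close> among the remaining agents extends
  a top set by one. Nonemptiness is what makes \<open>pmf_of_set\<close> the uniform distribution in
  \<open>selection_prob\<close>.\<close>

lemma top_sets_nonempty: "k \<le> N \<Longrightarrow> top_sets N k y \<noteq> {}"
proof (induction k)
  case 0
  have "{} \<in> top_sets N 0 y" by (simp add: top_sets_def)
  then show ?case by blast
next
  case (Suc k)
  then obtain S where S: "S \<subseteq> {..<N}" "card S = k" "\<And>i j. i \<in> S \<Longrightarrow> j \<in> {..<N} - S \<Longrightarrow> y j \<le> y i"
    by (fastforce simp: top_sets_def)
  have "finite S" using S(1) finite_subset by blast
  have "{..<N} - S \<noteq> {}" using S Suc.prems by (metis Diff_eq_empty_iff Suc_n_not_le_n card_lessThan finite_lessThan le_antisym subset_antisym)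
  then obtain j where "is_arg_max y (\<lambda>l. l \<in> {..<N} - S) j"
    using Max_in[of "y ` ({..<N} - S)"] Max_ge[of "y ` ({..<N} - S)"]
    unfolding is_arg_max_linorder by fastforce
  then have j: "j \<in> {..<N} - S" "\<And>l. l \<in> {..<N} - S \<Longrightarrow> y l \<le> y j"
    unfolding is_arg_max_linorder by blast+
  have "insert j S \<in> top_sets N (Suc k) y"
    using S j \<open>finite S\<close> by (auto simp: top_sets_def)
  then show ?case by blast
qed

lemma selection_prob_eq:
  assumes "k \<le> N"
  shows "selection_prob N k m \<xi> i =
    real (card {S \<in> top_sets N k (\<lambda>j. m j * \<xi> j). i \<in> S}) / real (card (top_sets N k (\<lambda>j. m j * \<xi> j)))"
  unfolding selection_prob_def
  by (subst measure_pmf_of_set[OF top_sets_nonempty[OF assms] finite_top_sets])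
     (simp add: Int_def)

lemma selection_prob_nonneg: "0 \<le> selection_prob N k m \<xi> i"
  and selection_prob_le_1: "selection_prob N k m \<xi> i \<le> 1"
  by (simp_all add: selection_prob_def)

lemma selection_prob_eq_0:
  assumes "k \<le> N" "\<And>S. S \<in> top_sets N k (\<lambda>j. m j * \<xi> j) \<Longrightarrow> i \<notin> S"
  shows "selection_prob N k m \<xi> i = 0"
proof -
  have "{S \<in> top_sets N k (\<lambda>j. m j * \<xi> j). i \<in> S} = {}" using assms(2) by blast
  then have "card {S \<in> top_sets N k (\<lambda>j. m j * \<xi> j). i \<in> S} = 0" by (simp only: card.empty)
  then show ?thesis by (subst selection_prob_eq[OF assms(1)]) simp
qed

lemma selection_prob_eq_1:
  assumes "k \<le> N" "\<And>S. S \<in> top_sets N k (\<lambda>j. m j * \<xi> j) \<Longrightarrow> i \<in> S"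
  shows "selection_prob N k m \<xi> i = 1"
proof -
  have "{S \<in> top_sets N k (\<lambda>j. m j * \<xi> j). i \<in> S} = top_sets N k (\<lambda>j. m j * \<xi> j)"
    using assms(2) by blast
  then show ?thesis
    using assms(1) top_sets_nonempty finite_top_sets by (simp add: selection_prob_eq)
qed

text \<open>Double counting over pairs of a top set and a member turns the weighted sum over agents
  into an average over top sets, so a bound for each single top set passes to the selection
  probabilities.\<close>

lemma sum_selection_prob:
  assumes "k \<le> N"
  defines "T m \<xi> \<equiv> top_sets N k (\<lambda>j. m j * \<xi> j)"
  shows "(\<Sum>i<N. selection_prob N k m \<xi> i * f i) = (\<Sum>S\<in>T m \<xi>. \<Sum>i\<in>S. f i) / real (card (T m \<xi>))"
proof -
  have fin: "finite (T m \<xi>)" by (simp add: T_def finite_top_sets)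
  have "(\<Sum>S\<in>T m \<xi>. \<Sum>i\<in>S. f i) = (\<Sum>S\<in>T m \<xi>. \<Sum>i<N. if i \<in> S then f i else 0)"
    by (intro sum.cong refl sum.mono_neutral_cong_left) (auto simp: T_def top_sets_def)
  also have "\<dots> = (\<Sum>i<N. \<Sum>S\<in>T m \<xi>. if i \<in> S then f i else 0)"
    by (rule sum.swap)
  also have "\<dots> = (\<Sum>i<N. real (card {S \<in> T m \<xi>. i \<in> S}) * f i)"
    by (intro sum.cong refl) (simp add: sum.If_cases[OF fin] Int_def)
  finally show ?thesis
    by (simp add: selection_prob_eq[OF assms(1)] T_def sum_divide_distrib)
qed

lemma sum_selection_prob_1:
  assumes "k \<le> N"
  shows "(\<Sum>i<N. selection_prob N k m \<xi> i) = real k"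
proof -
  have "card (top_sets N k (\<lambda>j. m j * \<xi> j)) \<noteq> 0"
    using top_sets_nonempty[OF assms] finite_top_sets by simp
  moreover have "(\<Sum>S\<in>top_sets N k (\<lambda>j. m j * \<xi> j). \<Sum>i\<in>S. 1 :: real) = (\<Sum>S\<in>top_sets N k (\<lambda>j. m j * \<xi> j). real k)"
    by (intro sum.cong) (auto simp: top_sets_def)
  ultimately show ?thesis
    using sum_selection_prob[OF assms, of m \<xi> "\<lambda>_. 1"] by simp
qed

lemma sum_selection_prob_ge:
  assumes "k \<le> N" "\<And>S. S \<in> top_sets N k (\<lambda>j. m j * \<xi> j) \<Longrightarrow> c \<le> (\<Sum>i\<in>S. f i)"
  shows "c \<le> (\<Sum>i<N. selection_prob N k m \<xi> i * f i)"
proof -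
  have "card (top_sets N k (\<lambda>j. m j * \<xi> j)) \<noteq> 0"
    using top_sets_nonempty[OF assms(1)] finite_top_sets by simp
  moreover have "real (card (top_sets N k (\<lambda>j. m j * \<xi> j))) * c \<le> (\<Sum>S\<in>top_sets N k (\<lambda>j. m j * \<xi> j). \<Sum>i\<in>S. f i)"
    using assms(2) by (rule sum_bounded_below)
  ultimately show ?thesis
    unfolding sum_selection_prob[OF assms(1), of m \<xi> f] by (simp add: pos_le_divide_eq mult.commute)
qed

text \<open>A nonnegative noise carries the order of messages over to observed values. Either the
  observed value is unchanged, or it rises strictly, and then the selection probability was 0 before
  or is 1 after.\<close>

lemma selection_prob_mono:
  assumes "k \<le> N" "i < N" "x \<le> x'" "0 \<le> \<xi> i"
  shows "selection_prob N k (m(i := x)) \<xi> i \<le> selection_prob N k (m(i := x')) \<xi> i"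
proof (cases "x * \<xi> i = x' * \<xi> i")
  case True
  then have "(\<lambda>j. (m(i := x)) j * \<xi> j) = (\<lambda>j. (m(i := x')) j * \<xi> j)" by auto
  then show ?thesis by (simp add: selection_prob_def)
next
  case False
  then have less: "x * \<xi> i < x' * \<xi> i" using assms by (simp add: mult_right_mono order.not_eq_order_implies_strict)
  let ?y = "\<lambda>j. (m(i := x)) j * \<xi> j" and ?y' = "\<lambda>j. (m(i := x')) j * \<xi> j"
  show ?thesis
  proof (cases "\<exists>S\<in>top_sets N k ?y. i \<in> S")
    case False
    then have "selection_prob N k (m(i := x)) \<xi> i = 0"
      using assms(1) by (intro selection_prob_eq_0) auto
    then show ?thesis by (simp add: selection_prob_nonneg)
  next
    case True
    then obtain S where S: "S \<in> top_sets N k ?y" "i \<in> S" by blast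
    \<comment> \<open>A tied agent that raises its observed value strictly is selected for sure.\<close>
    have "selection_prob N k (m(i := x')) \<xi> i = 1"
    proof (rule selection_prob_eq_1[OF assms(1)], rule ccontr)
      fix S' assume S': "S' \<in> top_sets N k ?y'" and "i \<notin> S'"
      have "card S' = card S" "finite S" using S S' by (auto simp: top_sets_def intro: finite_subset)
      then have "\<not> S' \<subseteq> S" using \<open>i \<notin> S'\<close> \<open>i \<in> S\<close> by (metis card_subset_eq)
      then obtain j where j: "j \<in> S'" "j \<notin> S" by blast
      then have "j < N" "j \<noteq> i" using S' S by (auto simp: top_sets_def)
      have "m j * \<xi> j \<le> x * \<xi> i"
        using top_setsD[OF S \<open>j < N\<close> j(2)] \<open>j \<noteq> i\<close> by simp
      moreover have "x' * \<xi> i \<le> m j * \<xi> j"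
        using top_setsD[OF S' j(1) assms(2) \<open>i \<notin> S'\<close>] \<open>j \<noteq> i\<close> by simp
      ultimately show False using less by simp
    qed
    then show ?thesis by (simp add: selection_prob_le_1)
  qed
qed

text \<open>The same \<open>m\<close> and \<open>\<xi>\<close> serve for the hypothetical message
  \<open>x\<close> and for the actual selection. A top set that excludes \<open>i\<close> in the
  hypothetical profile consists of \<open>k\<close> agents whose observed values do not depend on
  the message of \<open>i\<close>, so it bounds the actual selection from below.\<close>

lemma sum_selected_ge_rejection_prob:
  assumes "k \<le> N" "i < N" "0 < \<eta>" "\<eta> < 1" "0 \<le> x"
    and \<xi>: "\<And>j. j < N \<Longrightarrow> \<xi> j \<in> {1 - \<eta>..1 + \<eta>}" and m: "\<And>j. j < N \<Longrightarrow> 0 \<le> m j"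
  shows "real k * (x * (1 - \<eta>) / (1 + \<eta>)) * (1 - selection_prob N k (m(i := x)) \<xi> i)
    \<le> (\<Sum>j<N. selection_prob N k m \<xi> j * m j)"
proof (cases "\<exists>S\<in>top_sets N k (\<lambda>j. (m(i := x)) j * \<xi> j). i \<notin> S")
  case False
  then have "selection_prob N k (m(i := x)) \<xi> i = 1"
    using assms(1) by (intro selection_prob_eq_1) auto
  then show ?thesis
    using m by (auto intro!: sum_nonneg mult_nonneg_nonneg selection_prob_nonneg)
next
  case True
  then obtain S' where S': "S' \<in> top_sets N k (\<lambda>j. (m(i := x)) j * \<xi> j)" "i \<notin> S'" by blast
  \<comment> \<open>The least observed value that message \<open>x\<close> can produce under the
    noise; dividing by \<open>1 + \<eta>\<close> below converts it back into a bound on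
    messages.\<close>
  define \<tau> where "\<tau> = x * (1 - \<eta>)"
  have \<tau>: "\<tau> \<le> m j * \<xi> j" if "j \<in> S'" for j
  proof -
    have "\<tau> \<le> x * \<xi> i" unfolding \<tau>_def using \<xi>[OF assms(2)] assms(5) by (intro mult_left_mono) auto
    also have "\<dots> \<le> m j * \<xi> j"
      using top_setsD[OF S'(1) that assms(2) S'(2)] S'(2) that by (cases "j = i") simp_all
    finally show ?thesis .
  qed
  have "real k * (\<tau> / (1 + \<eta>)) \<le> (\<Sum>j<N. selection_prob N k m \<xi> j * m j)"
  proof (rule sum_selection_prob_ge[OF assms(1)])
    fix S assume S: "S \<in> top_sets N k (\<lambda>j. m j * \<xi> j)"
    have "\<tau> / (1 + \<eta>) \<le> m l" if l: "l \<in> S" for l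
    proof -
      have "l < N" using S l by (auto simp: top_sets_def)
      have "\<tau> \<le> m l * \<xi> l"
      proof (cases "l \<in> S'")
        case False
        \<comment> \<open>By equal cardinalities, since \<open>l\<close> lies in \<open>S\<close>
          only, some \<open>j\<close> of \<open>S'\<close> was passed over in favour of
          \<open>l\<close>.\<close>
        have "card S' = card S" "finite S" using S S' by (auto simp: top_sets_def intro: finite_subset)
        then have "\<not> S' \<subseteq> S" using False l card_subset_eq[of S S'] by blast
        then obtain j where j: "j \<in> S'" "j \<notin> S" by blast
        have "j < N" using j(1) S' by (auto simp: top_sets_def)
        then have "m j * \<xi> j \<le> m l * \<xi> l"
            using top_setsD[OF S l \<open>j < N\<close> j(2)] by simp
        then show ?thesis using \<tau>[OF j(1)] by linarith
      qed (rule \<tau>)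
      also have "\<dots> \<le> m l * (1 + \<eta>)"
        using \<xi>[OF \<open>l < N\<close>] m[OF \<open>l < N\<close>] by (intro mult_left_mono) auto
      finally show ?thesis using assms(3) by (simp add: field_simps)
    qed
    then have "of_nat (card S) * (\<tau> / (1 + \<eta>)) \<le> (\<Sum>i\<in>S. m i)"
      by (rule sum_bounded_below)
    then show "real k * (\<tau> / (1 + \<eta>)) \<le> (\<Sum>i\<in>S. m i)"
      using S by (simp add: top_sets_def)
  qed
  moreover have "real k * (\<tau> / (1 + \<eta>)) * (1 - selection_prob N k (m(i := x)) \<xi> i) \<le> real k * (\<tau> / (1 + \<eta>))"
    using assms by (intro mult_left_le) (auto simp: \<tau>_def selection_prob_nonneg)
  ultimately show ?thesis by (simp add: \<tau>_def)
qed

text \<open>There are finitely many candidate sets, and membership of a fixed one in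
  \<open>top_sets\<close> is a finite conjunction of comparisons of observed values; both
  cardinalities in \<open>selection_prob_eq\<close> are thus finite sums of measurable
  indicators.\<close>

lemma borel_measurable_selection_prob:
  assumes "k \<le> N" "i < N"
    and [measurable]: "\<And>j. j < N \<Longrightarrow> (\<lambda>\<omega>. m \<omega> j) \<in> borel_measurable M" "\<And>j. j < N \<Longrightarrow> (\<lambda>\<omega>. \<xi> \<omega> j) \<in> borel_measurable M"
  shows "(\<lambda>\<omega>. selection_prob N k (m \<omega>) (\<xi> \<omega>) i) \<in> borel_measurable M"
proof -
  let ?T = "\<lambda>\<omega>. top_sets N k (\<lambda>j. m \<omega> j * \<xi> \<omega> j)"
  have [measurable]: "Measurable.pred M (\<lambda>\<omega>. S \<in> ?T \<omega>)" if "S \<subseteq> {..<N}" for S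
  proof -
    have "finite S" using that finite_subset by blast
    have "Measurable.pred M (\<lambda>\<omega>. m \<omega> j * \<xi> \<omega> j \<le> m \<omega> l * \<xi> \<omega> l)" if "j < N" "l < N" for j l
      using that by measurable
    then show ?thesis
      unfolding top_sets_def mem_Collect_eq using that \<open>finite S\<close>
      by (intro pred_intros_logic pred_intros_finite) auto
  qed
  have card: "real (card {S \<in> ?T \<omega>. P S}) = (\<Sum>S\<in>Pow {..<N}. if S \<in> ?T \<omega> \<and> P S then 1 else 0)" for P \<omega>
    by (subst sum.If_cases) (auto simp: top_sets_def intro!: arg_cong[where f = card])
  have [measurable]: "(\<lambda>\<omega>. real (card {S \<in> ?T \<omega>. P S})) \<in> borel_measurable M" for P
    unfolding card by (intro borel_measurable_sum) auto
  have "(\<lambda>\<omega>. real (card {S \<in> ?T \<omega>. i \<in> S}) / real (card {S \<in> ?T \<omega>. True})) \<in> borel_measurable M"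
    by measurable
  then show ?thesis
    by (simp add: selection_prob_eq[OF assms(1)])
qed

subsection \<open>Best responses\<close>

text \<open>The probability with which a value is pooled. The fraction \<open>\<kappa>\<close> at
  the cutoff lets the pool meet a prescribed mean exactly even if the prior has atoms.\<close>

definition threshold_weight :: "real \<Rightarrow> real \<Rightarrow> real \<Rightarrow> real" where
  "threshold_weight \<theta> \<kappa> v = (if \<theta> < v then 1 else if v = \<theta> then \<kappa> else 0)"

lemma threshold_weight_measurable [measurable]: "threshold_weight \<theta> \<kappa> \<in> borel_measurable borel"
  unfolding threshold_weight_def[abs_def] by measurable

lemma threshold_weight_bounds:
  "\<kappa> \<in> {0..1} \<Longrightarrow> 0 \<le> threshold_weight \<theta> \<kappa> v" "\<kappa> \<in> {0..1} \<Longrightarrow> threshold_weight \<theta> \<kappa> v \<le> 1"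
  by (auto simp: threshold_weight_def)

text \<open>An intermediate value argument for a function with jumps: pooling everything gives a
  nonpositive excess over \<open>s\<close>, pooling only the values above \<open>s\<close> a
  nonnegative one. In the application \<open>f\<close> is the value and \<open>g\<close> the
  indicator of the low messages.\<close>

lemma exists_threshold_with_mean:
  fixes f g :: "'x \<Rightarrow> real"
  assumes "finite_measure M" and [measurable]: "f \<in> borel_measurable M" "g \<in> borel_measurable M"
    and f: "\<And>x. x \<in> space M \<Longrightarrow> f x \<in> {a..1}" and g: "\<And>x. x \<in> space M \<Longrightarrow> g x \<in> {0..1}"
    and s: "s \<in> {a..1}" and mean: "(\<integral>x. g x * (f x - s) \<partial>M) \<le> 0"
  shows "\<exists>\<theta>\<in>{a..s}. \<exists>\<kappa>\<in>{0..1}. (\<integral>x. g x * (f x - s) * threshold_weight \<theta> \<kappa> (f x) \<partial>M) = 0"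
proof -
  interpret finite_measure M by fact
  define H where "H t = (\<integral>x. g x * (f x - s) * (if t \<le> f x then 1 else 0) \<partial>M)" for t
  define K where "K t = (\<integral>x. g x * (f x - s) * (if t < f x then 1 else 0) \<partial>M)" for t
  have bound: "norm (g x * (f x - s)) \<le> 1 * (1 - a)" if "x \<in> space M" for x
    unfolding norm_mult using f[OF that] g[OF that] s by (intro mult_mono) auto
  have bound_if: "norm (g x * (f x - s) * (if P then 1 else 0)) \<le> 1 - a" if "x \<in> space M" for x P
    using bound[OF that] by (cases P) auto
  have int [simp]: "integrable M (\<lambda>x. g x * (f x - s) * (if t \<le> f x then 1 else 0))"
    "integrable M (\<lambda>x. g x * (f x - s) * (if t < f x then 1 else 0))" for t
    using bound_if by (auto intro!: integrable_const_bound[where B = "1 - a"])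
  define T where "T = {t \<in> {a..s}. H t \<le> 0}"
  have "H a = (\<integral>x. g x * (f x - s) \<partial>M)"
    unfolding H_def using f by (intro Bochner_Integration.integral_cong) auto
  then have "a \<in> T" using mean s by (auto simp: T_def)
  define \<theta> where "\<theta> = Sup T"
  have bdd: "bdd_above T" by (rule bdd_aboveI[of _ s]) (auto simp: T_def)
  have \<theta>: "a \<le> \<theta>" "\<theta> \<le> s"
    using \<open>a \<in> T\<close> bdd by (auto simp: \<theta>_def intro: cSup_upper) (auto simp: T_def intro!: cSup_least)
  \<comment> \<open>\<open>H\<close> is left-continuous with right limit \<open>K\<close>; the fraction \<open>\<kappa>\<close> of the atom at \<open>\<theta>\<close> bridges the jump.\<close>
  have "H \<theta> \<le> 0"
  proof -
    have "\<exists>t\<in>T. \<theta> - 1 / real (Suc n) < t" for n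
      using less_cSup_iff[of T "\<theta> - 1 / real (Suc n)"] \<open>a \<in> T\<close> bdd by (auto simp: \<theta>_def)
    then obtain t where t: "\<And>n. t n \<in> T" "\<And>n. \<theta> - 1 / real (Suc n) < t n" by metis
    have t_le: "t n \<le> \<theta>" for n using t(1) bdd by (auto simp: \<theta>_def intro: cSup_upper)
    have lim: "t \<longlonglongrightarrow> \<theta>"
    proof (rule real_tendsto_sandwich[of "\<lambda>n. \<theta> - 1 / real (Suc n)" t sequentially "\<lambda>_. \<theta>"])
      show "(\<lambda>n. \<theta> - 1 / real (Suc n)) \<longlonglongrightarrow> \<theta>"
        using tendsto_diff[OF tendsto_const[of \<theta>] LIMSEQ_inverse_real_of_nat] by (simp add: inverse_eq_divide)
    qed (use t t_le in \<open>auto intro!: always_eventually less_imp_le\<close>)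
    have "(\<lambda>n. H (t n)) \<longlonglongrightarrow> H \<theta>"
      unfolding H_def
    proof (rule integral_dominated_convergence[where w = "\<lambda>_. 1 - a"])
      show "AE x in M. (\<lambda>n. g x * (f x - s) * (if t n \<le> f x then 1 else 0)) \<longlonglongrightarrow>
        g x * (f x - s) * (if \<theta> \<le> f x then 1 else 0)"
      proof (intro AE_I2 tendsto_mult tendsto_const tendsto_eventually)
        fix x
        show "\<forall>\<^sub>F n in sequentially. (if t n \<le> f x then 1 else 0) = (if \<theta> \<le> f x then 1 else (0::real))"
        proof (cases "\<theta> \<le> f x")
          case True
          then show ?thesis using t_le order_trans by (auto intro!: always_eventually)
        next
          case False
          then have "\<forall>\<^sub>F n in sequentially. f x < t n" using lim by (intro order_tendstoD) auto
          then show ?thesis using False by (auto elim: eventually_mono)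
        qed
      qed
    qed (use bound_if in auto)
    then show ?thesis
      by (rule LIMSEQ_le_const2) (use t(1) in \<open>auto simp: T_def\<close>)
  qed
  have "0 \<le> K \<theta>"
  \<comment> \<open>At \<open>s\<close> the integrand is nonnegative. Below \<open>s\<close>, points
    of the interval slightly right of the supremum lie outside \<open>T\<close>, so \<open>H\<close>
    is positive there and \<open>K\<close> inherits the sign in the limit.\<close>
  proof (cases "\<theta> = s")
    case True
    then show ?thesis
      unfolding K_def using g by (intro Bochner_Integration.integral_nonneg) auto
  next
    case False
    then have "\<theta> < s" using \<theta> by simp
    define t where "t n = \<theta> + (s - \<theta>) * (1 / real (Suc n))" for n
    have t: "\<theta> < t n" "t n \<le> s" for n
    proof -
      show "\<theta> < t n" using \<open>\<theta> < s\<close> by (simp add: t_def)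
      have "(s - \<theta>) * (1 / real (Suc n)) \<le> s - \<theta>"
        using \<open>\<theta> < s\<close> by (intro mult_left_le) auto
      then show "t n \<le> s" by (simp add: t_def)
    qed
    have "\<forall>n. t n \<notin> T"
      using t(1) bdd cSup_upper[of _ T] by (auto simp: \<theta>_def not_le[symmetric])
    then have pos: "0 \<le> H (t n)" for n
      using t(1)[of n] t(2)[of n] \<theta> spec[of "\<lambda>n. t n \<notin> T" n] by (auto simp: T_def not_le)
    have lim: "t \<longlonglongrightarrow> \<theta>"
      unfolding t_def
      using tendsto_add[OF tendsto_const[of \<theta>] tendsto_mult[OF tendsto_const[of "s - \<theta>"] LIMSEQ_inverse_real_of_nat]]
      by (simp add: inverse_eq_divide)
    have "(\<lambda>n. H (t n)) \<longlonglongrightarrow> K \<theta>"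
      unfolding H_def K_def
    proof (rule integral_dominated_convergence[where w = "\<lambda>_. 1 - a"])
      show "AE x in M. (\<lambda>n. g x * (f x - s) * (if t n \<le> f x then 1 else 0)) \<longlonglongrightarrow>
        g x * (f x - s) * (if \<theta> < f x then 1 else 0)"
      proof (intro AE_I2 tendsto_mult tendsto_const tendsto_eventually)
        fix x
        show "\<forall>\<^sub>F n in sequentially. (if t n \<le> f x then 1 else 0) = (if \<theta> < f x then 1 else (0::real))"
        proof (cases "\<theta> < f x")
          case False
          then show ?thesis using t(1) by (auto intro!: always_eventually simp: not_less not_le intro: le_less_trans)
        next
          case True
          then have "\<forall>\<^sub>F n in sequentially. t n < f x" using lim by (intro order_tendstoD) auto
          then show ?thesis using True by (auto elim: eventually_mono)
        qed
      qed
    qed (use bound_if in auto)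
    then show ?thesis
      by (rule LIMSEQ_le_const) (use pos in auto)
  qed
  \<comment> \<open>The root of the affine function
    \<open>K \<theta> + \<kappa> * (H \<theta> - K \<theta>)\<close>; the separate value 0 avoids a
    zero denominator when \<open>H\<close> and \<open>K\<close> both vanish at
    \<open>\<theta>\<close>.\<close>
  define \<kappa>0 where "\<kappa>0 = (if K \<theta> = 0 then 0 else K \<theta> / (K \<theta> - H \<theta>))"
  have "\<kappa>0 \<in> {0..1}" "K \<theta> + \<kappa>0 * (H \<theta> - K \<theta>) = 0"
    using \<open>H \<theta> \<le> 0\<close> \<open>0 \<le> K \<theta>\<close> by (auto simp: \<kappa>0_def field_simps)
  moreover have "(\<integral>x. g x * (f x - s) * threshold_weight \<theta> l (f x) \<partial>M) = K \<theta> + l * (H \<theta> - K \<theta>)" for l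
  proof -
    have "(\<integral>x. g x * (f x - s) * threshold_weight \<theta> l (f x) \<partial>M) =
      (\<integral>x. g x * (f x - s) * (if \<theta> < f x then 1 else 0) + l * (g x * (f x - s) * (if \<theta> \<le> f x then 1 else 0)
         - g x * (f x - s) * (if \<theta> < f x then 1 else 0)) \<partial>M)"
      by (intro Bochner_Integration.integral_cong) (auto simp: threshold_weight_def)
    also have "\<dots> = K \<theta> + l * (H \<theta> - K \<theta>)"
      by (simp add: H_def K_def)
    finally show ?thesis .
  qed
  ultimately show ?thesis using \<theta> by (intro bexI[of _ \<theta>] bexI[of _ \<kappa>0]) auto
qed

section \<open>Strategies as measures on value-message pairs\<close>

abbreviation pair_space :: "real \<Rightarrow> (real \<times> real) measure" where
  "pair_space a \<equiv> value_space a \<Otimes>\<^sub>M value_space a"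

lemma space_value_space [simp]: "space (value_space a) = {a..1}"
  by (simp add: value_space_def space_restrict_space)

lemma space_pair_space: "space (pair_space a) = {a..1} \<times> {a..1}"
  by (simp add: space_pair_measure)

lemma id_value_space [measurable]: "(\<lambda>x. x) \<in> borel_measurable (value_space a)"
  unfolding value_space_def by (intro measurable_restrict_space1) simp

lemma fst_pair_space [measurable]: "fst \<in> borel_measurable (pair_space a)"
  using measurable_compose[OF measurable_fst id_value_space] by simp

lemma snd_pair_space [measurable]: "snd \<in> borel_measurable (pair_space a)"
  using measurable_compose[OF measurable_snd id_value_space] by simp

lemma measurable_value_spaceI:
  "f \<in> borel_measurable M \<Longrightarrow> (\<And>x. x \<in> space M \<Longrightarrow> f x \<in> {a..1}) \<Longrightarrow> f \<in> measurable M (value_space a)"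
  unfolding value_space_def by (rule measurable_restrict_space2) auto

lemma strategiesD:
  assumes "\<pi> \<in> strategies a P"
  shows "prob_space \<pi>" "sets \<pi> = sets (pair_space a)" "space \<pi> = {a..1} \<times> {a..1}"
    "distr \<pi> (value_space a) fst = P"
    "continuous_on {a..1} h \<Longrightarrow> (\<integral>(v, m). (v - m) * h m \<partial>\<pi>) = 0"
proof -
  show *: "prob_space \<pi>" "sets \<pi> = sets (pair_space a)" "distr \<pi> (value_space a) fst = P"
    "continuous_on {a..1} h \<Longrightarrow> (\<integral>(v, m). (v - m) * h m \<partial>\<pi>) = 0"
    using assms by (auto simp: strategies_def space_prob_algebra)
  show "space \<pi> = {a..1} \<times> {a..1}"
    using sets_eq_imp_space_eq[OF *(2)] by (simp add: space_pair_measure)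
qed

lemma continuous_on_interval_bound:
  fixes h :: "real \<Rightarrow> real"
  assumes "continuous_on {a..b} h"
  shows "\<exists>B. \<forall>x\<in>{a..b}. \<bar>h x\<bar> \<le> B"
  using compact_imp_bounded[OF compact_continuous_image[OF assms compact_Icc]]
  by (auto simp: bounded_iff)

text \<open>The indicator of \<open>{s..}\<close> is a pointwise limit of continuous functions of the message.\<close>

lemma strategy_upper_mean:
  assumes "\<pi> \<in> strategies a P" "continuous_on {a..1} h"
  shows "(\<integral>(v, m). (if s \<le> m then (v - m) * h m else 0) \<partial>\<pi>) = 0"
proof -
  interpret prob_space \<pi> using strategiesD(1)[OF assms(1)] .
  note [measurable_cong] = strategiesD(2)[OF assms(1)]
  \<comment> \<open>A continuous ramp: for positive \<open>n\<close> it is 1 from \<open>s\<close>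
    upwards and 0 below \<open>s - 1 / n\<close>.\<close>
  define q where "q n m = max 0 (min 1 (1 - real n * (s - m)))" for n m
  have hm: "h \<in> borel_measurable (value_space a)"
    unfolding value_space_def using assms(2) by (rule borel_measurable_continuous_on_restrict)
  have [measurable]: "(\<lambda>x. h (snd x)) \<in> borel_measurable \<pi>"
    using measurable_compose[OF measurable_snd hm, of "value_space a"] by measurable
  have [measurable]: "q n \<in> borel_measurable borel" for n
    unfolding q_def[abs_def] by measurable
  obtain B where B: "\<And>x. x \<in> {a..1} \<Longrightarrow> \<bar>h x\<bar> \<le> B"
    using continuous_on_interval_bound[OF assms(2)] by blast
  have b: "\<bar>(fst x - snd x) * h (snd x)\<bar> \<le> \<bar>1 - a\<bar> * B" if "x \<in> space \<pi>" for x
    unfolding abs_mult using that strategiesD(3)[OF assms(1)] B[of "snd x"]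
    by (intro mult_mono) auto
  have "(\<lambda>n. \<integral>x. (fst x - snd x) * h (snd x) * q n (snd x) \<partial>\<pi>) \<longlonglongrightarrow>
     (\<integral>x. (if s \<le> snd x then (fst x - snd x) * h (snd x) else 0) \<partial>\<pi>)"
  proof (rule integral_dominated_convergence[where w = "\<lambda>_. \<bar>1 - a\<bar> * B"])
    show "AE x in \<pi>. (\<lambda>n. (fst x - snd x) * h (snd x) * q n (snd x)) \<longlonglongrightarrow>
       (if s \<le> snd x then (fst x - snd x) * h (snd x) else 0)"
    proof (intro AE_I2 tendsto_eventually)
      fix x :: "real \<times> real"
      show "\<forall>\<^sub>F n in sequentially. (fst x - snd x) * h (snd x) * q n (snd x) =
          (if s \<le> snd x then (fst x - snd x) * h (snd x) else 0)"
      proof (cases "s \<le> snd x")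
        case True
        then have "real n * (s - snd x) \<le> 0" for n by (simp add: mult_nonneg_nonpos)
        then have "q n (snd x) = 1" for n
          unfolding q_def by (smt (verit) max_def min_def)
        then show ?thesis using True by simp
      next
        case False
        obtain n0 where n0: "1 < real n0 * (s - snd x)"
          using reals_Archimedean3[of "s - snd x"] False by auto
        have "q n (snd x) = 0" if "n \<ge> n0" for n
        proof -
          have "real n0 * (s - snd x) \<le> real n * (s - snd x)" using that False by (intro mult_right_mono) auto
          then show ?thesis using n0 by (simp add: q_def)
        qed
        then show ?thesis using False by (auto simp: eventually_sequentially)
      qed
    qed
    show "AE x in \<pi>. norm ((fst x - snd x) * h (snd x) * q n (snd x)) \<le> \<bar>1 - a\<bar> * B" for n
    proof (intro AE_I2)
      fix x assume "x \<in> space \<pi>"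
      have "\<bar>q n (snd x)\<bar> \<le> 1" by (simp add: q_def)
      then have "\<bar>(fst x - snd x) * h (snd x)\<bar> * \<bar>q n (snd x)\<bar> \<le> \<bar>(fst x - snd x) * h (snd x)\<bar>"
        by (intro mult_left_le) auto
      then show "norm ((fst x - snd x) * h (snd x) * q n (snd x)) \<le> \<bar>1 - a\<bar> * B"
        using b[OF \<open>x \<in> space \<pi>\<close>] by (simp add: abs_mult)
    qed
  qed auto
  \<comment> \<open>The product of \<open>h\<close> and the ramp is itself a continuous test
    function.\<close>
  moreover have "(\<integral>x. (fst x - snd x) * h (snd x) * q n (snd x) \<partial>\<pi>) = 0" for n
    using strategiesD(5)[OF assms(1), of "\<lambda>m. h m * q n m"] assms(2)
    by (simp add: q_def case_prod_unfold mult.assoc continuous_intros)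
  ultimately have "(\<lambda>n. 0) \<longlonglongrightarrow> (\<integral>x. (if s \<le> snd x then (fst x - snd x) * h (snd x) else 0) \<partial>\<pi>)"
    by simp
  then show ?thesis
    by (simp add: LIMSEQ_const_iff case_prod_unfold)
qed

text \<open>The deviation is the image of \<open>\<pi>\<close> and an independent coin of bias
  \<open>\<kappa>\<close> that splits the atom at \<open>\<theta>\<close>. Its mean condition has
  three parts: kept messages inherit it by \<open>strategy_upper_mean\<close>, revealed values
  satisfy it trivially, and the pool satisfies it by the hypothesis \<open>mean\<close>.\<close>

lemma pooling_deviation:
  assumes \<pi>: "\<pi> \<in> strategies a P" and s: "s \<in> {a..1}" and l: "\<kappa> \<in> {0..1}"
    and mean: "(\<integral>(v, m). (if m < s then 1 else 0) * (v - s) * threshold_weight \<theta> \<kappa> v \<partial>\<pi>) = 0"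
  obtains \<pi>' where "\<pi>' \<in> strategies a P"
    and "\<And>H B. H \<in> borel_measurable (pair_space a) \<Longrightarrow> (\<And>x. x \<in> {a..1} \<times> {a..1} \<Longrightarrow> \<bar>H x\<bar> \<le> B) \<Longrightarrow>
      (\<integral>x. H x \<partial>\<pi>') = (\<integral>(v, m). (if s \<le> m then H (v, m) else
         threshold_weight \<theta> \<kappa> v * H (v, s) + (1 - threshold_weight \<theta> \<kappa> v) * H (v, v)) \<partial>\<pi>)"
proof -
  interpret prob_space \<pi> using strategiesD(1)[OF \<pi>] .
  note [measurable_cong] = strategiesD(2)[OF \<pi>]
  let ?B = "measure_pmf (bernoulli_pmf \<kappa>)"
  interpret B: prob_space ?B by (rule prob_space_measure_pmf)
  interpret PB: pair_prob_space \<pi> ?B ..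
  define m' where "m' x b = (if s \<le> snd x then snd x else if \<theta> < fst x \<or> fst x = \<theta> \<and> b then s else fst x)"
    for x :: "real \<times> real" and b :: bool
  define G where "G z = (fst (fst z), m' (fst z) (snd z))" for z
  have [measurable]: "(\<lambda>z. m' (fst z) (snd z)) \<in> borel_measurable (\<pi> \<Otimes>\<^sub>M ?B)"
    unfolding m'_def by measurable
  have G [measurable]: "G \<in> measurable (\<pi> \<Otimes>\<^sub>M ?B) (pair_space a)"
    unfolding G_def using s strategiesD(3)[OF \<pi>]
    by (intro measurable_Pair measurable_value_spaceI) (auto simp: space_pair_measure m'_def)
  define \<pi>' where "\<pi>' = distr (\<pi> \<Otimes>\<^sub>M ?B) (pair_space a) G"
  interpret D: prob_space \<pi>' unfolding \<pi>'_def by (rule PB.prob_space_distr) measurable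
  have int: "(\<integral>x. H x \<partial>\<pi>') = (\<integral>(v, m). (if s \<le> m then H (v, m) else
         threshold_weight \<theta> \<kappa> v * H (v, s) + (1 - threshold_weight \<theta> \<kappa> v) * H (v, v)) \<partial>\<pi>)"
    if [measurable]: "H \<in> borel_measurable (pair_space a)" and B: "\<And>x. x \<in> {a..1} \<times> {a..1} \<Longrightarrow> \<bar>H x\<bar> \<le> B" for H B
  proof -
    have "(\<integral>x. H x \<partial>\<pi>') = (\<integral>z. H (G z) \<partial>(\<pi> \<Otimes>\<^sub>M ?B))"
      unfolding \<pi>'_def by (rule integral_distr) measurable
    also have "\<dots> = (\<integral>x. \<integral>b. H (G (x, b)) \<partial>?B \<partial>\<pi>)"
    proof (rule PB.integral_fst'[symmetric])
      show "integrable (\<pi> \<Otimes>\<^sub>M ?B) (\<lambda>z. H (G z))"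
        using measurable_space[OF G] B by (intro PB.integrable_const_bound[where B = B] AE_I2) (auto simp: space_pair_space)
    qed
    \<comment> \<open>Averaging over the coin turns its two outcomes into the weights of
      \<open>threshold_weight\<close>.\<close>
    also have "\<dots> = (\<integral>x. H (G (x, True)) * \<kappa> + H (G (x, False)) * (1 - \<kappa>) \<partial>\<pi>)"
      using l by simp
    also have "\<dots> = (\<integral>(v, m). (if s \<le> m then H (v, m) else
         threshold_weight \<theta> \<kappa> v * H (v, s) + (1 - threshold_weight \<theta> \<kappa> v) * H (v, v)) \<partial>\<pi>)"
      by (intro Bochner_Integration.integral_cong)
         (auto simp: G_def m'_def threshold_weight_def algebra_simps)
    finally show ?thesis .
  qed
  \<comment> \<open>Only the message is changed, so the value keeps its law.\<close>
  have "distr \<pi>' (value_space a) fst = distr (\<pi> \<Otimes>\<^sub>M ?B) (value_space a) (\<lambda>z. fst (fst z))"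
    unfolding \<pi>'_def by (subst distr_distr) (auto simp: G_def comp_def)
  also have "\<dots> = distr (distr (\<pi> \<Otimes>\<^sub>M ?B) \<pi> fst) (value_space a) fst"
    by (subst distr_distr) (auto simp: comp_def)
  also have "distr (\<pi> \<Otimes>\<^sub>M ?B) \<pi> fst = \<pi>"
    by (rule prob_space.distr_pair_fst[OF prob_space_measure_pmf])
  finally have marg: "distr \<pi>' (value_space a) fst = P"
    using strategiesD(4)[OF \<pi>] by simp
  have "\<pi>' \<in> strategies a P"
    unfolding strategies_def space_prob_algebra mem_Collect_eq
  proof (intro conjI allI impI marg D.prob_space_axioms)
    show "sets \<pi>' = sets (pair_space a)" by (simp add: \<pi>'_def)
    fix h :: "real \<Rightarrow> real" assume h: "continuous_on {a..1} h"
    have hm: "h \<in> borel_measurable (value_space a)"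
      unfolding value_space_def using h by (rule borel_measurable_continuous_on_restrict)
    have hs [measurable]: "(\<lambda>x. h (snd x)) \<in> borel_measurable (pair_space a)"
      using measurable_compose[OF measurable_snd hm] .
    obtain B where B: "\<And>x. x \<in> {a..1} \<Longrightarrow> \<bar>h x\<bar> \<le> B"
      using continuous_on_interval_bound[OF h] by blast
    have b: "\<bar>(fst x - snd x) * h (snd x)\<bar> \<le> \<bar>1 - a\<bar> * B" if "x \<in> {a..1} \<times> {a..1}" for x
      unfolding abs_mult using that B[of "snd x"] by (intro mult_mono) auto
    \<comment> \<open>The term of the revealed values vanishes because their message equals the
      value.\<close>
    have "(\<integral>x. (fst x - snd x) * h (snd x) \<partial>\<pi>') = (\<integral>(v, m). (if s \<le> m then (v - m) * h m else 0) +
        h s * ((if m < s then 1 else 0) * (v - s) * threshold_weight \<theta> \<kappa> v) \<partial>\<pi>)"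
      by (subst int[OF _ b]) (auto intro!: Bochner_Integration.integral_cong)
    also have "\<dots> = (\<integral>(v, m). (if s \<le> m then (v - m) * h m else 0) \<partial>\<pi>) +
        h s * (\<integral>(v, m). (if m < s then 1 else 0) * (v - s) * threshold_weight \<theta> \<kappa> v \<partial>\<pi>)"
    proof -
      have 1: "integrable \<pi> (\<lambda>x. if s \<le> snd x then (fst x - snd x) * h (snd x) else 0)"
      proof (rule integrable_const_bound[where B = "\<bar>\<bar>1 - a\<bar> * B\<bar>"])
        show "AE x in \<pi>. norm (if s \<le> snd x then (fst x - snd x) * h (snd x) else 0) \<le> \<bar>\<bar>1 - a\<bar> * B\<bar>"
          using b strategiesD(3)[OF \<pi>] by (intro AE_I2) fastforce
      qed measurable
      have 2: "integrable \<pi> (\<lambda>x. (if snd x < s then 1 else 0) * (fst x - s) * threshold_weight \<theta> \<kappa> (fst x))"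
      proof (rule integrable_const_bound[where B = "1 * (1 - a) * 1"])
        show "AE x in \<pi>. norm ((if snd x < s then 1 else 0) * (fst x - s) * threshold_weight \<theta> \<kappa> (fst x)) \<le> 1 * (1 - a) * 1"
          unfolding norm_mult using s strategiesD(3)[OF \<pi>] threshold_weight_bounds[OF l]
          by (intro AE_I2 mult_mono) auto
      qed measurable
      show ?thesis using 1 2 by (simp add: case_prod_unfold)
    qed
    also have "\<dots> = 0" using mean strategy_upper_mean[OF \<pi> h] by simp
    finally show "(\<integral>(v, m). (v - m) * h m \<partial>\<pi>') = 0" by (simp add: case_prod_unfold)
  qed
  then show ?thesis using int that by blast
qed

text \<open>Here \<open>r\<close> stands for the winning probability as a function of the message.
  Optimality against the pooling deviation gives an inequality weighted by \<open>u\<close>; a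
  single crossing at \<open>\<theta>\<close> removes \<open>u\<close>, and the mean equation of the
  pool then converts winning probabilities into excess value.\<close>

lemma best_response_bound:
  assumes \<pi>: "\<pi> \<in> strategies a P" and "0 < a" and s: "s \<in> {a..1}"
    and u: "continuous_on {a..1} u" "mono_on {a..1} u" "\<And>x. x \<in> {a..1} \<Longrightarrow> 0 < u x"
    and r: "mono r" "\<And>m. 0 \<le> r m" "\<And>m. r m \<le> (1::real)"
    and opt: "\<And>\<pi>'. \<pi>' \<in> strategies a P \<Longrightarrow> (\<integral>x. r (snd x) * u (fst x) \<partial>\<pi>') \<le> (\<integral>x. r (snd x) * u (fst x) \<partial>\<pi>)"
  shows "r s * (\<integral>v. max 0 (v - s) \<partial>P) \<le> (\<integral>x. r (snd x) * (if s \<le> snd x then snd x else s) \<partial>\<pi>)"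
proof -
  interpret prob_space \<pi> using strategiesD(1)[OF \<pi>] .
  note [measurable_cong] = strategiesD(2)[OF \<pi>]
  note sp = strategiesD(3)[OF \<pi>]
  have bdd: "integrable \<pi> f" if "f \<in> borel_measurable \<pi>" "\<And>x. x \<in> {a..1} \<times> {a..1} \<Longrightarrow> \<bar>f x\<bar> \<le> B" for f :: "_ \<Rightarrow> real" and B
    using that sp by (intro integrable_const_bound[where B = B] AE_I2) auto
  have [measurable]: "r \<in> borel_measurable borel" using r(1) by (rule borel_measurable_mono)
  have um: "u \<in> borel_measurable (value_space a)"
    unfolding value_space_def using u(1) by (rule borel_measurable_continuous_on_restrict)
  have [measurable]: "(\<lambda>x. u (fst x)) \<in> borel_measurable (pair_space a)"
    using measurable_compose[OF measurable_fst um] .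
  have u_le: "u x \<le> u 1" if "x \<in> {a..1}" for x
    using u(2) that by (auto simp: mono_on_def)
  define low :: "real \<times> real \<Rightarrow> real" where "low x = (if snd x < s then 1 else 0)" for x
  define up :: "real \<times> real \<Rightarrow> real" where "up x = (if s \<le> snd x then 1 else 0)" for x
  have [measurable]: "low \<in> borel_measurable \<pi>" "up \<in> borel_measurable \<pi>"
    unfolding low_def[abs_def] up_def[abs_def] by measurable
  have "(\<integral>x. up x * (fst x - snd x) \<partial>\<pi>) = 0"
    using strategy_upper_mean[OF \<pi>, of "\<lambda>_. 1" s]
    by (simp add: up_def case_prod_unfold if_distrib[of "\<lambda>c. c * _"] cong: if_cong)
  moreover have "integrable \<pi> (\<lambda>x. up x * fst x)" "integrable \<pi> (\<lambda>x. up x * snd x)"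
    using \<open>0 < a\<close> by (auto intro!: bdd[of _ 1] simp: up_def)
  ultimately have up_mean: "(\<integral>x. up x * fst x \<partial>\<pi>) = (\<integral>x. up x * snd x \<partial>\<pi>)"
    by (simp add: right_diff_distrib)
  have low_mean: "(\<integral>x. low x * (fst x - s) \<partial>\<pi>) \<le> 0"
  proof -
    \<comment> \<open>Low messages are below \<open>s\<close>, so replacing \<open>s\<close> by the
      message increases the integrand; the result is the full mean condition minus its part on high
      messages, both zero.\<close>
    have "(\<integral>x. low x * (fst x - s) \<partial>\<pi>) \<le> (\<integral>x. (fst x - snd x) - up x * (fst x - snd x) \<partial>\<pi>)"
    proof (rule integral_mono)
      show "integrable \<pi> (\<lambda>x. low x * (fst x - s))" "integrable \<pi> (\<lambda>x. (fst x - snd x) - up x * (fst x - snd x))"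
        using \<open>0 < a\<close> s by (auto intro!: bdd[of _ 1] simp: up_def low_def)
    qed (auto simp: low_def up_def)
    also have "\<dots> = (\<integral>x. fst x - snd x \<partial>\<pi>) - (\<integral>x. up x * (fst x - snd x) \<partial>\<pi>)"
      using \<open>0 < a\<close> s by (intro Bochner_Integration.integral_diff bdd[of _ 1]) (auto simp: up_def)
    also have "\<dots> = 0"
      using strategiesD(5)[OF \<pi>, of "\<lambda>_. 1"] \<open>(\<integral>x. up x * (fst x - snd x) \<partial>\<pi>) = 0\<close>
      by (simp add: case_prod_unfold)
    finally show ?thesis .
  qed
  obtain \<theta> \<kappa> where \<theta>: "\<theta> \<in> {a..s}" and l: "\<kappa> \<in> {0..1}"
    and mean: "(\<integral>x. low x * (fst x - s) * threshold_weight \<theta> \<kappa> (fst x) \<partial>\<pi>) = 0"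
  proof -
    have "low x \<in> {0..1}" for x by (simp add: low_def)
    then show ?thesis
      using exists_threshold_with_mean[of \<pi> fst low a s] low_mean s sp finite_measure_axioms that by auto
  qed
  define w where "w x = threshold_weight \<theta> \<kappa> (fst x)" for x :: "real \<times> real"
  have [measurable]: "w \<in> borel_measurable \<pi>" unfolding w_def[abs_def] by measurable
  have w: "0 \<le> w x" "w x \<le> 1" for x using threshold_weight_bounds[OF l] by (auto simp: w_def)
  obtain \<pi>' where \<pi>': "\<pi>' \<in> strategies a P"
    and int: "\<And>H B. H \<in> borel_measurable (pair_space a) \<Longrightarrow> (\<And>x. x \<in> {a..1} \<times> {a..1} \<Longrightarrow> \<bar>H x\<bar> \<le> B) \<Longrightarrow>
      (\<integral>x. H x \<partial>\<pi>') = (\<integral>(v, m). (if s \<le> m then H (v, m) else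
         threshold_weight \<theta> \<kappa> v * H (v, s) + (1 - threshold_weight \<theta> \<kappa> v) * H (v, v)) \<partial>\<pi>)"
    using pooling_deviation[OF \<pi> s l, of \<theta>] mean by (auto simp: low_def case_prod_unfold)
  have ru: "0 \<le> r y * u x" "r y * u x \<le> u 1" if "x \<in> {a..1}" for x y
    using r(2,3)[of y] u(3)[OF that] u_le[OF that] mult_mono[of "r y" 1 "u x" "u 1"] by auto
  have wru: "w z * (r y * u x) \<le> u 1" "0 \<le> w z * (r y * u x)" if "x \<in> {a..1}" for x y z
    using w[of z] ru[OF that, of y] mult_mono[of "w z" 1 "r y * u x" "u 1"] by auto
  have rw: "\<bar>r y - r s * w x\<bar> \<le> 1" for x y
  proof -
    have "r s * w x \<le> 1 * 1" "0 \<le> r s * w x"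
      using r(2,3)[of s] w[of x] by (intro mult_mono mult_nonneg_nonneg; simp)+
    then show ?thesis using r(2,3)[of y] unfolding abs_le_iff by linarith
  qed
  \<comment> \<open>Only the pooled values count as a gain of the deviation: what the revealed ones win is dropped.\<close>
  have "(\<integral>x. up x * (r (snd x) * u (fst x)) + low x * (w x * (r s * u (fst x))) \<partial>\<pi>) \<le> (\<integral>x. r (snd x) * u (fst x) \<partial>\<pi>')"
  proof (subst int[of _ "u 1"])
    show "(\<integral>x. up x * (r (snd x) * u (fst x)) + low x * (w x * (r s * u (fst x))) \<partial>\<pi>)
      \<le> (\<integral>(v, m). (if s \<le> m then r (snd (v, m)) * u (fst (v, m)) else threshold_weight \<theta> \<kappa> v * (r (snd (v, s)) * u (fst (v, s)))
           + (1 - threshold_weight \<theta> \<kappa> v) * (r (snd (v, v)) * u (fst (v, v)))) \<partial>\<pi>)"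
      unfolding case_prod_unfold fst_conv snd_conv w_def[symmetric]
    proof (rule integral_mono)
      show "integrable \<pi> (\<lambda>x. up x * (r (snd x) * u (fst x)) + low x * (w x * (r s * u (fst x))))"
        using ru wru by (auto intro!: bdd[of _ "u 1"] simp: up_def low_def)
      show "integrable \<pi> (\<lambda>x. if s \<le> snd x then r (snd x) * u (fst x) else w x * (r s * u (fst x)) + (1 - w x) * (r (fst x) * u (fst x)))"
      proof (rule bdd[of _ "u 1"])
        fix x :: "real \<times> real" assume x: "x \<in> {a..1} \<times> {a..1}"
        have "0 \<le> w x * (r s * u (fst x)) + (1 - w x) * (r (fst x) * u (fst x))"
          using ru[of "fst x"] w[of x] x by auto
        moreover have "w x * (r s * u (fst x)) + (1 - w x) * (r (fst x) * u (fst x)) \<le> w x * u 1 + (1 - w x) * u 1"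
          using ru[of "fst x"] w[of x] x by (intro add_mono mult_left_mono) auto
        ultimately show "\<bar>if s \<le> snd x then r (snd x) * u (fst x) else w x * (r s * u (fst x)) + (1 - w x) * (r (fst x) * u (fst x))\<bar> \<le> u 1"
          using ru[of "fst x" "snd x"] x by (auto simp: algebra_simps)
      qed measurable
      fix x assume "x \<in> space \<pi>"
      then have "0 \<le> (1 - w x) * (r (fst x) * u (fst x))"
        using ru[of "fst x"] w[of x] sp by auto
      then show "up x * (r (snd x) * u (fst x)) + low x * (w x * (r s * u (fst x)))
         \<le> (if s \<le> snd x then r (snd x) * u (fst x) else w x * (r s * u (fst x)) + (1 - w x) * (r (fst x) * u (fst x)))"
        by (auto simp: up_def low_def)
    qed
  qed (use ru in auto)
  also have "\<dots> \<le> (\<integral>x. r (snd x) * u (fst x) \<partial>\<pi>)" by (rule opt[OF \<pi>'])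
  finally have "0 \<le> (\<integral>x. r (snd x) * u (fst x) \<partial>\<pi>) - (\<integral>x. up x * (r (snd x) * u (fst x)) + low x * (w x * (r s * u (fst x))) \<partial>\<pi>)"
    by simp
  also have "\<dots> = (\<integral>x. r (snd x) * u (fst x) - (up x * (r (snd x) * u (fst x)) + low x * (w x * (r s * u (fst x)))) \<partial>\<pi>)"
    using ru wru by (intro Bochner_Integration.integral_diff[symmetric] bdd[of _ "u 1"]) (auto simp: up_def low_def)
  \<comment> \<open>High messages are the same in both strategies, so their terms cancel.\<close>
  also have "\<dots> = (\<integral>x. low x * ((r (snd x) - r s * w x) * u (fst x)) \<partial>\<pi>)"
    by (intro Bochner_Integration.integral_cong) (auto simp: up_def low_def algebra_simps)
  \<comment> \<open>\<open>r (snd x) - r s * w x\<close> is nonpositive above \<open>\<theta>\<close> and nonnegative below it, while \<open>u\<close> increases.\<close>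
  also have "\<dots> \<le> (\<integral>x. u \<theta> * (low x * (r (snd x) - r s * w x)) \<partial>\<pi>)"
  proof (rule integral_mono)
    show "integrable \<pi> (\<lambda>x. u \<theta> * (low x * (r (snd x) - r s * w x)))"
      using rw by (intro integrable_mult_right bdd[of _ 1]) (auto simp: low_def)
    show "integrable \<pi> (\<lambda>x. low x * ((r (snd x) - r s * w x) * u (fst x)))"
    proof (rule bdd[of _ "1 * (1 * u 1)"])
      show "\<bar>low x * ((r (snd x) - r s * w x) * u (fst x))\<bar> \<le> 1 * (1 * u 1)" if "x \<in> {a..1} \<times> {a..1}" for x
        unfolding abs_mult using rw u(3)[of "fst x"] u_le[of "fst x"] that
        by (intro mult_mono) (auto simp: low_def)
    qed measurable
    fix x assume "x \<in> space \<pi>"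
    then have x: "fst x \<in> {a..1}" using sp by auto
    have \<theta>': "\<theta> \<in> {a..1}" using \<theta> s by auto
    have "(r (snd x) - r s * w x) * u (fst x) \<le> (r (snd x) - r s * w x) * u \<theta>" if "snd x < s"
    proof (cases "fst x" \<theta> rule: linorder_cases)
      case greater
      then have "w x = 1" by (simp add: w_def threshold_weight_def)
      moreover have "r (snd x) \<le> r s" using r(1) that by (auto simp: mono_def)
      moreover have "u \<theta> \<le> u (fst x)" using u(2) x \<theta>' greater by (auto simp: mono_on_def)
      ultimately show ?thesis by (intro mult_left_mono_neg) auto
    next
      case less
      then have "w x = 0" by (simp add: w_def threshold_weight_def)
      moreover have "u (fst x) \<le> u \<theta>" using u(2) x \<theta>' less by (auto simp: mono_on_def)
      ultimately show ?thesis using r(2)[of "snd x"] by (intro mult_left_mono) auto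
    qed simp
    then show "low x * ((r (snd x) - r s * w x) * u (fst x)) \<le> u \<theta> * (low x * (r (snd x) - r s * w x))"
      by (auto simp: low_def mult.commute)
  qed
  finally have "0 \<le> u \<theta> * (\<integral>x. low x * (r (snd x) - r s * w x) \<partial>\<pi>)" by simp
  \<comment> \<open>Division by the positive \<open>u \<theta>\<close> leaves a comparison of
    winning probabilities alone.\<close>
  then have "0 \<le> (\<integral>x. low x * (r (snd x) - r s * w x) \<partial>\<pi>)"
    using u(3)[of \<theta>] \<theta> s by (auto simp: zero_le_mult_iff)
  also have "\<dots> = (\<integral>x. low x * r (snd x) \<partial>\<pi>) - r s * (\<integral>x. low x * w x \<partial>\<pi>)"
  proof -
    have "integrable \<pi> (\<lambda>x. low x * r (snd x))" "integrable \<pi> (\<lambda>x. low x * w x)"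
      using r w by (auto intro!: bdd[of _ 1] simp: low_def)
    moreover have "low x * (r (snd x) - r s * w x) = low x * r (snd x) - r s * (low x * w x)" for x
      by (simp add: algebra_simps)
    ultimately show ?thesis by simp
  qed
  finally have low_win: "r s * (\<integral>x. low x * w x \<partial>\<pi>) \<le> (\<integral>x. low x * r (snd x) \<partial>\<pi>)" by simp

  have ints: "integrable \<pi> (\<lambda>x. up x * fst x)" "integrable \<pi> (\<lambda>x. up x * snd x)" "integrable \<pi> (\<lambda>x. low x * w x)"
    "integrable \<pi> (\<lambda>x. low x * r (snd x))"
    using \<open>0 < a\<close> w r by (auto intro!: bdd[of _ 1] simp: up_def low_def)
  have int_mean: "integrable \<pi> (\<lambda>x. low x * (fst x - s) * w x)"
  proof (rule bdd[of _ "1 * (1 - a) * 1"])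
    show "\<bar>low x * (fst x - s) * w x\<bar> \<le> 1 * (1 - a) * 1" if "x \<in> {a..1} \<times> {a..1}" for x
      unfolding abs_mult using that s w[of x] by (intro mult_mono) (auto simp: low_def)
  qed measurable
  have rm: "0 \<le> r y * x" "r y * x \<le> 1" if "x \<in> {a..1}" for x y
    using r(2,3)[of y] that \<open>0 < a\<close> mult_mono[of "r y" 1 x 1] by auto
  have int_up: "integrable \<pi> (\<lambda>x. up x * (r (snd x) * snd x))"
    using rm by (auto intro!: bdd[of _ 1] simp: up_def)
  have "(\<integral>v. max 0 (v - s) \<partial>P) = (\<integral>x. max 0 (fst x - s) \<partial>\<pi>)"
    unfolding strategiesD(4)[OF \<pi>, symmetric] by (rule integral_distr) measurable
  \<comment> \<open>On high messages the excess is at most the value. On low ones it is at most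
    \<open>fst x * w x\<close>, because \<open>\<theta> \<le> s\<close> puts every value above
    \<open>s\<close> fully into the pool; this is split as
    \<open>(fst x - s) * w x + s * w x\<close>, whose first part has mean zero.\<close>
  also have "\<dots> \<le> (\<integral>x. up x * fst x + (low x * (fst x - s) * w x + s * (low x * w x)) \<partial>\<pi>)"
  proof (rule integral_mono)
    show "integrable \<pi> (\<lambda>x. max 0 (fst x - s))"
      using \<open>0 < a\<close> s by (auto intro!: bdd[of _ 1])
    show "integrable \<pi> (\<lambda>x. up x * fst x + (low x * (fst x - s) * w x + s * (low x * w x)))"
      using ints int_mean by simp
    fix x assume "x \<in> space \<pi>"
    then have x: "0 < fst x" using sp \<open>0 < a\<close> by auto
    have "max 0 (fst x - s) \<le> fst x * w x"
    proof (cases "fst x > s")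
      case True
      then have "w x = 1" using \<theta> by (simp add: w_def threshold_weight_def)
      then show ?thesis using True s \<open>0 < a\<close> by auto
    qed (use x w in auto)
    then show "max 0 (fst x - s) \<le> up x * fst x + (low x * (fst x - s) * w x + s * (low x * w x))"
      using x s \<open>0 < a\<close> by (auto simp: up_def low_def algebra_simps)
  qed
  also have "\<dots> = (\<integral>x. up x * fst x \<partial>\<pi>) + s * (\<integral>x. low x * w x \<partial>\<pi>)"
    using ints int_mean mean by (simp add: w_def)
  finally have "r s * (\<integral>v. max 0 (v - s) \<partial>P) \<le> r s * ((\<integral>x. up x * snd x \<partial>\<pi>) + s * (\<integral>x. low x * w x \<partial>\<pi>))"
    unfolding up_mean using r(2) by (intro mult_left_mono) auto
  also have "\<dots> = (\<integral>x. r s * (up x * snd x) \<partial>\<pi>) + s * (r s * (\<integral>x. low x * w x \<partial>\<pi>))"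
    by (simp add: distrib_left mult.left_commute)
  \<comment> \<open>Monotonicity of \<open>r\<close> handles the high messages,
    \<open>low_win\<close> the low ones.\<close>
  also have "\<dots> \<le> (\<integral>x. up x * (r (snd x) * snd x) \<partial>\<pi>) + s * (\<integral>x. low x * r (snd x) \<partial>\<pi>)"
  proof (intro add_mono integral_mono mult_left_mono low_win)
    fix x assume "x \<in> space \<pi>"
    then show "r s * (up x * snd x) \<le> up x * (r (snd x) * snd x)"
      using r(1) sp \<open>0 < a\<close> by (auto simp: up_def mono_def intro!: mult_right_mono)
  qed (use ints int_up s \<open>0 < a\<close> in auto)
  also have "\<dots> = (\<integral>x. up x * (r (snd x) * snd x) + s * (low x * r (snd x)) \<partial>\<pi>)"
    using ints int_up by simp
  also have "\<dots> = (\<integral>x. r (snd x) * (if s \<le> snd x then snd x else s) \<partial>\<pi>)"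
    by (intro Bochner_Integration.integral_cong) (auto simp: up_def low_def)
  finally show ?thesis .
qed

subsection \<open>Equilibrium welfare\<close>

lemma prob_space_noise: "0 < \<eta> \<Longrightarrow> prob_space (noise \<eta>)"
  unfolding noise_def by (rule prob_space_uniform_measure) auto

lemma sets_noise [measurable_cong, simp]: "sets (noise \<eta>) = sets borel"
  by (simp add: noise_def)

lemma AE_noise: "0 < \<eta> \<Longrightarrow> AE x in noise \<eta>. x \<in> {1 - \<eta>..1 + \<eta>}"
  unfolding noise_def by (rule AE_uniform_measureI) auto

lemma distr_pair_snd:
  assumes "prob_space M" "prob_space M'"
  shows "distr (M \<Otimes>\<^sub>M M') M' snd = M'"
proof -
  interpret M: prob_space M by fact
  interpret M': prob_space M' by fact
  interpret pair_prob_space M M' ..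
  show ?thesis
  proof (rule measure_eqI)
    fix A assume "A \<in> sets (distr (M \<Otimes>\<^sub>M M') M' snd)"
    then have A: "A \<in> sets M'" by simp
    then have "snd -` A \<inter> space (M \<Otimes>\<^sub>M M') = space M \<times> A"
      using sets.sets_into_space by (fastforce simp: space_pair_measure)
    then show "emeasure (distr (M \<Otimes>\<^sub>M M') M' snd) A = emeasure M' A"
      using A by (simp add: emeasure_distr M'.emeasure_pair_measure_Times M.emeasure_space_1)
  qed simp
qed

section \<open>Winning probabilities and welfare in a fixed profile of strategies\<close>

locale noisy_persuasion =
  fixes N k :: nat and a \<eta> :: real and F :: "nat \<Rightarrow> real measure" and \<pi> :: "nat \<Rightarrow> (real \<times> real) measure"
  assumes k: "1 \<le> k" "k \<le> N" and a: "0 < a" "a < 1" and \<eta>: "0 < \<eta>" "\<eta> < 1"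
    and strategy: "\<And>i. i < N \<Longrightarrow> \<pi> i \<in> strategies a (F i)"
begin

abbreviation noises :: "(nat \<Rightarrow> real) measure" where
  "noises \<equiv> PiM {..<N} (\<lambda>_. noise \<eta>)"

lemma prob_space_noises: "prob_space noises"
  by (intro prob_space_PiM prob_space_noise \<eta>)

lemma AE_noises: "AE \<xi> in noises. \<forall>j<N. \<xi> j \<in> {1 - \<eta>..1 + \<eta>}"
proof -
  have "\<forall>j\<in>{..<N}. AE \<xi> in noises. \<xi> j \<in> {1 - \<eta>..1 + \<eta>}"
    using AE_PiM_component[of "{..<N}" "\<lambda>_. noise \<eta>"] prob_space_noise AE_noise \<eta> by blast
  then have "AE \<xi> in noises. \<forall>j\<in>{..<N}. \<xi> j \<in> {1 - \<eta>..1 + \<eta>}"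
    by (intro AE_finite_allI) auto
  then show ?thesis by eventually_elim auto
qed

lemma sets_strategy [measurable_cong]: "i < N \<Longrightarrow> sets (\<pi> i) = sets (pair_space a)"
  using strategiesD(2)[OF strategy] .

lemma prob_space_outcome: "prob_space (outcome_space N \<eta> \<pi>)"
proof -
  interpret noises: prob_space noises by (rule prob_space_noises)
  interpret Q: prob_space "PiM {..<N} \<pi>" using strategiesD(1)[OF strategy] by (intro prob_space_PiM) auto
  interpret pair_prob_space "PiM {..<N} \<pi>" noises ..
  show ?thesis unfolding outcome_space_def by unfold_locales
qed

abbreviation others :: "nat \<Rightarrow> ((nat \<Rightarrow> real \<times> real) \<times> (nat \<Rightarrow> real)) measure" where
  "others i \<equiv> PiM ({..<N} - {i}) \<pi> \<Otimes>\<^sub>M noises"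

text \<open>The interim winning probability: the messages of the others and all noises, including
  that of \<open>i\<close>, are averaged out. It does not involve \<open>\<pi> i\<close>, so it is
  the same before and after a deviation of \<open>i\<close>.\<close>

definition win_prob :: "nat \<Rightarrow> real \<Rightarrow> real" where
  "win_prob i x = (\<integral>z. selection_prob N k ((\<lambda>j. snd (fst z j))(i := x)) (snd z) i \<partial>others i)"

lemma prob_space_others: "prob_space (others i)"
proof -
  interpret noises: prob_space noises by (rule prob_space_noises)
  interpret Q: prob_space "PiM ({..<N} - {i}) \<pi>" using strategiesD(1)[OF strategy] by (intro prob_space_PiM) auto
  interpret pair_prob_space "PiM ({..<N} - {i}) \<pi>" noises ..
  show ?thesis by unfold_locales
qed

text \<open>Fubini, with the coordinate of agent \<open>i\<close> split off. The choice
  \<open>\<pi>' = \<pi> i\<close> covers the original profile as well.\<close>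

lemma integral_outcome_update:
  assumes i: "i < N" and \<pi>': "\<pi>' \<in> strategies a (F i)"
    and f: "f \<in> borel_measurable (outcome_space N \<eta> (\<pi>(i := \<pi>')))" and B: "\<And>\<omega>. \<omega> \<in> space (outcome_space N \<eta> (\<pi>(i := \<pi>'))) \<Longrightarrow> \<bar>f \<omega>\<bar> \<le> (B::real)"
  shows "(\<integral>\<omega>. f \<omega> \<partial>outcome_space N \<eta> (\<pi>(i := \<pi>'))) = (\<integral>x. \<integral>z. f ((fst z)(i := x), snd z) \<partial>others i \<partial>\<pi>')"
proof -
  let ?I = "{..<N} - {i}" and ?P = "\<pi>(i := \<pi>')"
  let ?R = "PiM ?I \<pi>" and ?P' = "PiM {..<N} ?P"
  interpret noises: prob_space noises by (rule prob_space_noises)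
  interpret \<pi>': prob_space \<pi>' using strategiesD(1)[OF \<pi>'] .
  interpret R: prob_space ?R using strategiesD(1)[OF strategy] by (intro prob_space_PiM) auto
  interpret P': prob_space ?P'
    using strategiesD(1)[OF strategy] \<pi>'.prob_space_axioms by (intro prob_space_PiM) auto
  interpret PN: pair_prob_space ?P' noises ..
  interpret RN: pair_prob_space ?R noises ..
  interpret \<pi>R: pair_prob_space \<pi>' ?R ..
  have ins: "insert i ?I = {..<N}" using i by auto
  have R_eq: "PiM ?I ?P = ?R" by (intro PiM_cong) auto
  \<comment> \<open>Inserting an independent coordinate at \<open>i\<close> recovers the product
    over all agents.\<close>
  have distr: "distr (\<pi>' \<Otimes>\<^sub>M ?R) ?P' (\<lambda>(x, X). X(i := x)) = ?P'"
    by (rule distr_pair_PiM_eq_PiM[of ?I ?P i, unfolded ins R_eq fun_upd_same])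
       (use strategiesD(1)[OF strategy] \<pi>'.prob_space_axioms in auto)
  note [measurable] = f[unfolded outcome_space_def]
  have upd [measurable]: "(\<lambda>(x, X). X(i := x)) \<in> measurable (\<pi>' \<Otimes>\<^sub>M ?R) ?P'"
    using measurable_compose[OF measurable_pair_swap' measurable_add_dim[of i ?I ?P, unfolded ins R_eq fun_upd_same]]
    by (simp add: case_prod_unfold del: fun_upd_apply)
  \<comment> \<open>The noises are integrated out first, so that the splitting concerns the pairs
    only.\<close>
  define g where "g X = (\<integral>\<xi>. f (X, \<xi>) \<partial>noises)" for X
  have [measurable]: "g \<in> borel_measurable ?P'" unfolding g_def by measurable
  have Bf: "\<bar>f (X, \<xi>)\<bar> \<le> B" if "X \<in> space ?P'" "\<xi> \<in> space noises" for X \<xi>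
    using B that by (simp add: outcome_space_def space_pair_measure)
  have Bg: "\<bar>g X\<bar> \<le> B" if "X \<in> space ?P'" for X
  proof -
    have "\<bar>g X\<bar> \<le> (\<integral>\<xi>. \<bar>f (X, \<xi>)\<bar> \<partial>noises)"
      unfolding g_def by (rule integral_abs_bound)
    also have "\<dots> \<le> (\<integral>\<xi>. B \<partial>noises)"
      by (rule integral_mono') (use Bf[OF that] in \<open>auto intro: order_trans[OF abs_ge_zero]\<close>)
    finally show ?thesis by (simp add: noises.prob_space)
  qed
  have "(\<integral>\<omega>. f \<omega> \<partial>outcome_space N \<eta> ?P) = (\<integral>X. g X \<partial>?P')"
    unfolding outcome_space_def g_def
    by (rule PN.integral_fst'[symmetric])
       (use B in \<open>auto intro!: PN.integrable_const_bound[where B = B] simp: outcome_space_def\<close>)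
  also have "\<dots> = (\<integral>z. g ((snd z)(i := fst z)) \<partial>(\<pi>' \<Otimes>\<^sub>M ?R))"
    by (subst distr[symmetric], subst integral_distr) (auto simp: case_prod_unfold)
  also have "\<dots> = (\<integral>x. \<integral>X. g (X(i := x)) \<partial>?R \<partial>\<pi>')"
    by (subst \<pi>R.integral_fst'[symmetric])
       (use Bg measurable_space[OF upd] in \<open>auto intro!: \<pi>R.integrable_const_bound[where B = B] simp: case_prod_unfold\<close>)
  also have "\<dots> = (\<integral>x. \<integral>z. f ((fst z)(i := x), snd z) \<partial>others i \<partial>\<pi>')"
  proof (rule Bochner_Integration.integral_cong[OF refl])
    fix x assume x: "x \<in> space \<pi>'"
    have ux [measurable]: "(\<lambda>X. X(i := x)) \<in> measurable ?R ?P'"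
      using measurable_compose[OF measurable_Pair[OF measurable_const[OF x] measurable_ident] upd] by simp
    show "(\<integral>X. g (X(i := x)) \<partial>?R) = (\<integral>z. f ((fst z)(i := x), snd z) \<partial>others i)"
      unfolding g_def
      by (subst RN.integral_fst'[symmetric])
         (use Bf measurable_space[OF ux] in \<open>auto intro!: RN.integrable_const_bound[where B = B] simp: space_pair_measure\<close>)
  qed
  finally show ?thesis .
qed

lemma component_measurable:
  assumes "\<And>j. j \<in> I \<Longrightarrow> sets (P j) = sets (pair_space a)" "j \<in> I"
  shows "(\<lambda>X. snd (X j)) \<in> borel_measurable (PiM I P)"
  using measurable_component_singleton[OF assms(2), of P] measurable_cong_sets[OF refl assms(1)[OF assms(2)]]
    measurable_compose[OF _ snd_pair_space] by blast

lemma noise_measurable: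
  assumes "j < N"
  shows "(\<lambda>\<xi>. \<xi> j) \<in> borel_measurable noises"
  using measurable_component_singleton[of j "{..<N}" "\<lambda>_. noise \<eta>"] assms
  by (simp cong: measurable_cong_sets)

lemma selection_measurable:
  assumes "i < N" "\<And>j. j < N \<Longrightarrow> sets (P j) = sets (pair_space a)"
  shows "(\<lambda>\<omega>. selection_prob N k (\<lambda>j. snd (fst \<omega> j)) (snd \<omega>) i) \<in> borel_measurable (outcome_space N \<eta> P)"
  unfolding outcome_space_def
proof (rule borel_measurable_selection_prob[OF k(2) assms(1)])
  fix j assume j: "j < N"
  show "(\<lambda>\<omega>. snd (fst \<omega> j)) \<in> borel_measurable (PiM {..<N} P \<Otimes>\<^sub>M noises)"
    using measurable_compose[OF measurable_fst component_measurable[of "{..<N}" P j]] assms(2) j by simp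
  show "(\<lambda>\<omega>. snd \<omega> j) \<in> borel_measurable (PiM {..<N} P \<Otimes>\<^sub>M noises)"
    using measurable_compose[OF measurable_snd noise_measurable[OF j]] .
qed

lemma win_measurable:
  assumes "i < N"
  shows "(\<lambda>z. selection_prob N k ((\<lambda>j. snd (fst z j))(i := x)) (snd z) i) \<in> borel_measurable (others i)"
proof (rule borel_measurable_selection_prob[OF k(2) assms(1)])
  fix j assume j: "j < N"
  show "(\<lambda>z. ((\<lambda>j. snd (fst z j))(i := x)) j) \<in> borel_measurable (others i)"
    using measurable_compose[OF measurable_fst component_measurable[of "{..<N} - {i}" \<pi> j]] sets_strategy j
    by (cases "j = i") auto
  show "(\<lambda>z. snd z j) \<in> borel_measurable (others i)"
    using measurable_compose[OF measurable_snd noise_measurable[OF j]] .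
qed

lemma win_integrable:
  assumes "i < N"
  shows "integrable (others i) (\<lambda>z. selection_prob N k ((\<lambda>j. snd (fst z j))(i := x)) (snd z) i)"
proof -
  interpret prob_space "others i" by (rule prob_space_others)
  show ?thesis
    using win_measurable[OF assms] selection_prob_nonneg selection_prob_le_1
    by (intro integrable_const_bound[where B = 1] AE_I2) auto
qed

lemma win_prob_bounds: "i < N \<Longrightarrow> 0 \<le> win_prob i x" "i < N \<Longrightarrow> win_prob i x \<le> 1"
proof -
  interpret prob_space "others i" by (rule prob_space_others)
  assume i: "i < N"
  show "0 \<le> win_prob i x" unfolding win_prob_def by (simp add: selection_prob_nonneg)
  show "win_prob i x \<le> 1" unfolding win_prob_def
    using win_integrable[OF i] by (intro integral_le_const AE_I2 selection_prob_le_1)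
qed

lemma AE_others_noise: "AE z in others i. \<forall>j<N. snd z j \<in> {1 - \<eta>..1 + \<eta>}"
proof -
  interpret noises: prob_space noises by (rule prob_space_noises)
  interpret R: prob_space "PiM ({..<N} - {i}) \<pi>" using strategiesD(1)[OF strategy] by (intro prob_space_PiM) auto
  have "AE z in distr (others i) noises snd. \<forall>j<N. z j \<in> {1 - \<eta>..1 + \<eta>}"
    unfolding distr_pair_snd[OF R.prob_space_axioms noises.prob_space_axioms] by (rule AE_noises)
  then show ?thesis by (rule AE_distrD[OF measurable_snd])
qed

text \<open>Pointwise monotonicity needs a nonnegative noise, which holds almost surely because
  \<open>\<eta> < 1\<close>.\<close>

lemma win_prob_mono:
  assumes "i < N"
  shows "mono (win_prob i)"
proof
  fix x x' :: real assume "x \<le> x'"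
  show "win_prob i x \<le> win_prob i x'"
    unfolding win_prob_def
  proof (rule integral_mono_AE[OF win_integrable[OF assms] win_integrable[OF assms]])
    show "AE z in others i. selection_prob N k ((\<lambda>j. snd (fst z j))(i := x)) (snd z) i
        \<le> selection_prob N k ((\<lambda>j. snd (fst z j))(i := x')) (snd z) i"
      using AE_others_noise[of i]
      by eventually_elim
        (use assms \<eta> \<open>x \<le> x'\<close> k in \<open>auto intro!: selection_prob_mono dest!: spec[of _ i]\<close>)
  qed
qed

text \<open>One formula for three uses: \<open>\<phi>\<close> is the utility of the value in
  \<open>utility_eq\<close>, the message in \<open>social_welfare_eq\<close>, and the constant 1 in
  \<open>sum_win_prob\<close>.\<close>

lemma selection_integral:
  assumes i: "i < N" and \<pi>': "\<pi>' \<in> strategies a (F i)"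
    and \<phi>: "\<phi> \<in> borel_measurable (pair_space a)" "\<And>x. x \<in> {a..1} \<times> {a..1} \<Longrightarrow> \<bar>\<phi> x\<bar> \<le> B"
  shows "(\<integral>\<omega>. selection_prob N k (\<lambda>j. snd (fst \<omega> j)) (snd \<omega>) i * \<phi> (fst \<omega> i) \<partial>outcome_space N \<eta> (\<pi>(i := \<pi>')))
    = (\<integral>x. win_prob i (snd x) * \<phi> x \<partial>\<pi>')"
proof -
  have sets: "sets ((\<pi>(i := \<pi>')) j) = sets (pair_space a)" if "j < N" for j
    using sets_strategy strategiesD(2)[OF \<pi>'] that by auto
  have comp: "(\<lambda>\<omega>. fst \<omega> i) \<in> measurable (outcome_space N \<eta> (\<pi>(i := \<pi>'))) (pair_space a)"
    unfolding outcome_space_def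
    using measurable_compose[OF measurable_fst measurable_component_singleton[of i "{..<N}" "\<pi>(i := \<pi>')"]]
      i sets[OF i] by (simp cong: measurable_cong_sets)
  have "(\<integral>\<omega>. selection_prob N k (\<lambda>j. snd (fst \<omega> j)) (snd \<omega>) i * \<phi> (fst \<omega> i) \<partial>outcome_space N \<eta> (\<pi>(i := \<pi>')))
    = (\<integral>x. \<integral>z. selection_prob N k (\<lambda>j. snd (((fst z)(i := x)) j)) (snd z) i * \<phi> x \<partial>others i \<partial>\<pi>')"
  proof (subst integral_outcome_update[OF i \<pi>', where B = "1 * B"])
    show "(\<lambda>\<omega>. selection_prob N k (\<lambda>j. snd (fst \<omega> j)) (snd \<omega>) i * \<phi> (fst \<omega> i)) \<in> borel_measurable (outcome_space N \<eta> (\<pi>(i := \<pi>')))"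
      by (intro borel_measurable_times selection_measurable[OF i sets] measurable_compose[OF comp \<phi>(1)])
    fix \<omega> assume "\<omega> \<in> space (outcome_space N \<eta> (\<pi>(i := \<pi>')))"
    then have "fst \<omega> i \<in> {a..1} \<times> {a..1}" using measurable_space[OF comp] by (simp add: space_pair_space)
    then show "\<bar>selection_prob N k (\<lambda>j. snd (fst \<omega> j)) (snd \<omega>) i * \<phi> (fst \<omega> i)\<bar> \<le> 1 * B"
      unfolding abs_mult using \<phi>(2) selection_prob_nonneg selection_prob_le_1 by (intro mult_mono) auto
  qed simp
  also have "\<dots> = (\<integral>x. win_prob i (snd x) * \<phi> x \<partial>\<pi>')"
  proof (rule Bochner_Integration.integral_cong[OF refl])
    fix x :: "real \<times> real"
    have *: "(\<lambda>j. snd ((X(i := x)) j)) = (\<lambda>j. snd (X j))(i := snd x)" for X :: "nat \<Rightarrow> real \<times> real"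
      by auto
    show "(\<integral>z. selection_prob N k (\<lambda>j. snd (((fst z)(i := x)) j)) (snd z) i * \<phi> x \<partial>others i) = win_prob i (snd x) * \<phi> x"
      unfolding * win_prob_def by simp
  qed
  finally show ?thesis .
qed

lemma utility_eq:
  assumes "i < N" "\<pi>' \<in> strategies a (F i)" "continuous_on {a..1} (u i)"
  shows "utility N k \<eta> u (\<pi>(i := \<pi>')) i = (\<integral>x. win_prob i (snd x) * u i (fst x) \<partial>\<pi>')"
proof -
  have um: "u i \<in> borel_measurable (value_space a)"
    unfolding value_space_def using assms(3) by (rule borel_measurable_continuous_on_restrict)
  obtain B where B: "\<And>x. x \<in> {a..1} \<Longrightarrow> \<bar>u i x\<bar> \<le> B"
    using continuous_on_interval_bound[OF assms(3)] by blast
  show ?thesis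
    unfolding utility_def case_prod_unfold
    using measurable_compose[OF measurable_fst um] B
    by (intro selection_integral[OF assms(1,2), where B = B]) auto
qed

lemma outcome_message_bounds:
  assumes "\<omega> \<in> space (outcome_space N \<eta> \<pi>)" "j < N"
  shows "snd (fst \<omega> j) \<in> {a..1}"
proof -
  have "fst \<omega> j \<in> space (\<pi> j)"
    using assms by (auto simp: outcome_space_def space_pair_measure space_PiM PiE_def Pi_def)
  then show ?thesis using strategiesD(3)[OF strategy[OF assms(2)]] by auto
qed

lemma selected_value_integrable:
  assumes "i < N"
  shows "integrable (outcome_space N \<eta> \<pi>) (\<lambda>\<omega>. selection_prob N k (\<lambda>j. snd (fst \<omega> j)) (snd \<omega>) i * snd (fst \<omega> i))"
proof -
  interpret prob_space "outcome_space N \<eta> \<pi>" by (rule prob_space_outcome)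
  have "(\<lambda>\<omega>. snd (fst \<omega> i)) \<in> borel_measurable (outcome_space N \<eta> \<pi>)"
    unfolding outcome_space_def
    using measurable_compose[OF measurable_fst component_measurable[of "{..<N}" \<pi> i]] sets_strategy assms by simp
  then have meas: "(\<lambda>\<omega>. selection_prob N k (\<lambda>j. snd (fst \<omega> j)) (snd \<omega>) i * snd (fst \<omega> i)) \<in> borel_measurable (outcome_space N \<eta> \<pi>)"
    by (intro borel_measurable_times selection_measurable[OF assms sets_strategy])
  show ?thesis
  proof (rule integrable_const_bound[OF _ meas, where B = "1 * 1"], rule AE_I2)
    fix \<omega> assume "\<omega> \<in> space (outcome_space N \<eta> \<pi>)"
    then show "norm (selection_prob N k (\<lambda>j. snd (fst \<omega> j)) (snd \<omega>) i * snd (fst \<omega> i)) \<le> 1 * 1"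
      unfolding norm_mult using outcome_message_bounds[OF _ assms, of \<omega>] a selection_prob_nonneg selection_prob_le_1
      by (intro mult_mono) auto
  qed
qed

lemma social_welfare_eq:
  "social_welfare N k \<eta> \<pi> = (\<Sum>i<N. \<integral>x. win_prob i (snd x) * snd x \<partial>\<pi> i)"
proof -
  have "social_welfare N k \<eta> \<pi> = (\<Sum>i<N. \<integral>\<omega>. selection_prob N k (\<lambda>j. snd (fst \<omega> j)) (snd \<omega>) i * snd (fst \<omega> i) \<partial>outcome_space N \<eta> \<pi>)"
    unfolding social_welfare_def case_prod_unfold
    by (rule Bochner_Integration.integral_sum) (use selected_value_integrable in auto)
  also have "\<dots> = (\<Sum>i<N. \<integral>x. win_prob i (snd x) * snd x \<partial>\<pi> i)"
    using selection_integral[OF _ strategy, of _ snd 1] a by (intro sum.cong refl) auto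
  finally show ?thesis .
qed

text \<open>Every outcome selects exactly \<open>k\<close> agents. This controls the sum of the
  terms \<open>s\<close> times winning probability in the final estimate.\<close>

lemma sum_win_prob: "(\<Sum>i<N. \<integral>x. win_prob i (snd x) \<partial>\<pi> i) = real k"
proof -
  interpret prob_space "outcome_space N \<eta> \<pi>" by (rule prob_space_outcome)
  have "(\<Sum>i<N. \<integral>x. win_prob i (snd x) \<partial>\<pi> i) =
    (\<Sum>i<N. \<integral>\<omega>. selection_prob N k (\<lambda>j. snd (fst \<omega> j)) (snd \<omega>) i \<partial>outcome_space N \<eta> \<pi>)"
    using selection_integral[OF _ strategy, of _ "\<lambda>_. 1" 1] by (intro sum.cong refl) auto
  also have "\<dots> = (\<integral>\<omega>. (\<Sum>i<N. selection_prob N k (\<lambda>j. snd (fst \<omega> j)) (snd \<omega>) i) \<partial>outcome_space N \<eta> \<pi>)"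
    using selection_measurable[OF _ sets_strategy] selection_prob_nonneg selection_prob_le_1
    by (intro Bochner_Integration.integral_sum[symmetric] integrable_const_bound[where B = 1] AE_I2) auto
  also have "\<dots> = real k"
    by (simp add: sum_selection_prob_1[OF k(2)] prob_space)
  finally show ?thesis .
qed

text \<open>Each of the \<open>k\<close> selected messages is at least \<open>a\<close>. The bound
  makes welfare positive and keeps the price of anarchy away from division by zero.\<close>

lemma social_welfare_ge: "real k * a \<le> social_welfare N k \<eta> \<pi>"
proof -
  interpret prob_space "outcome_space N \<eta> \<pi>" by (rule prob_space_outcome)
  show ?thesis
    unfolding social_welfare_def case_prod_unfold
  proof (rule integral_ge_const)
    show "integrable (outcome_space N \<eta> \<pi>) (\<lambda>\<omega>. \<Sum>i<N. selection_prob N k (\<lambda>j. snd (fst \<omega> j)) (snd \<omega>) i * snd (fst \<omega> i))"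
      using selected_value_integrable by (intro Bochner_Integration.integrable_sum) auto
    show "AE \<omega> in outcome_space N \<eta> \<pi>. real k * a \<le> (\<Sum>i<N. selection_prob N k (\<lambda>j. snd (fst \<omega> j)) (snd \<omega>) i * snd (fst \<omega> i))"
    proof (rule AE_I2)
      fix \<omega> assume \<omega>: "\<omega> \<in> space (outcome_space N \<eta> \<pi>)"
      have "real k * a = (\<Sum>i<N. selection_prob N k (\<lambda>j. snd (fst \<omega> j)) (snd \<omega>) i * a)"
        using sum_selection_prob_1[OF k(2)] by (simp add: sum_distrib_right[symmetric])
      also have "\<dots> \<le> (\<Sum>i<N. selection_prob N k (\<lambda>j. snd (fst \<omega> j)) (snd \<omega>) i * snd (fst \<omega> i))"
        using outcome_message_bounds[OF \<omega>] by (intro sum_mono mult_left_mono selection_prob_nonneg) auto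
      finally show "real k * a \<le> (\<Sum>i<N. selection_prob N k (\<lambda>j. snd (fst \<omega> j)) (snd \<omega>) i * snd (fst \<omega> i))" .
    qed
  qed
qed

text \<open>The expectation of \<open>sum_selected_ge_rejection_prob\<close> over the outcomes of
  the profile.\<close>

lemma rejection_prob_bound:
  assumes i: "i < N" and x: "0 \<le> x"
  shows "real k * (x * (1 - \<eta>) / (1 + \<eta>)) * (1 - win_prob i x) \<le> social_welfare N k \<eta> \<pi>"
proof -
  interpret prob_space "outcome_space N \<eta> \<pi>" by (rule prob_space_outcome)
  interpret noises: prob_space noises by (rule prob_space_noises)
  interpret Q: prob_space "PiM {..<N} \<pi>" using strategiesD(1)[OF strategy] by (intro prob_space_PiM) auto
  let ?c = "real k * (x * (1 - \<eta>) / (1 + \<eta>))"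
  let ?f = "\<lambda>\<omega>. selection_prob N k ((\<lambda>j. snd (fst \<omega> j))(i := x)) (snd \<omega>) i"
  have meas: "?f \<in> borel_measurable (outcome_space N \<eta> \<pi>)"
    unfolding outcome_space_def
  proof (rule borel_measurable_selection_prob[OF k(2) i])
    fix j assume j: "j < N"
    show "(\<lambda>\<omega>. ((\<lambda>j. snd (fst \<omega> j))(i := x)) j) \<in> borel_measurable (PiM {..<N} \<pi> \<Otimes>\<^sub>M noises)"
      using measurable_compose[OF measurable_fst component_measurable[of "{..<N}" \<pi> j]] sets_strategy j
      by (cases "j = i") auto
    show "(\<lambda>\<omega>. snd \<omega> j) \<in> borel_measurable (PiM {..<N} \<pi> \<Otimes>\<^sub>M noises)"
    using measurable_compose[OF measurable_snd noise_measurable[OF j]] .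
  qed
  have int: "integrable (outcome_space N \<eta> \<pi>) ?f"
    using meas selection_prob_nonneg selection_prob_le_1
    by (intro integrable_const_bound[where B = 1] AE_I2) auto
  \<comment> \<open>Overwriting the message of \<open>i\<close> by \<open>x\<close> erases the draw
    from \<open>\<pi> i\<close>, so on the full outcome space the expectation is still
    \<open>win_prob i x\<close>.\<close>
  have "(\<integral>\<omega>. ?f \<omega> \<partial>outcome_space N \<eta> \<pi>) = (\<integral>y. \<integral>z. ?f ((fst z)(i := y), snd z) \<partial>others i \<partial>\<pi> i)"
    using integral_outcome_update[OF i strategy[OF i], of ?f 1] meas selection_prob_nonneg selection_prob_le_1 by simp
  also have "\<dots> = (\<integral>y. win_prob i x \<partial>\<pi> i)"
  proof -
    have "(\<lambda>j. snd ((X(i := y)) j))(i := x) = (\<lambda>j. snd (X j))(i := x)" for X :: "nat \<Rightarrow> real \<times> real" and y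
      by auto
    then show ?thesis by (simp add: win_prob_def)
  qed
  also have "\<dots> = win_prob i x"
    using prob_space.prob_space[OF strategiesD(1)[OF strategy[OF i]]] by simp
  finally have "?c * (1 - win_prob i x) = (\<integral>\<omega>. ?c * (1 - ?f \<omega>) \<partial>outcome_space N \<eta> \<pi>)"
    using int by (simp add: prob_space)
  also have "\<dots> \<le> social_welfare N k \<eta> \<pi>"
    unfolding social_welfare_def case_prod_unfold
  proof (rule integral_mono_AE)
    show "integrable (outcome_space N \<eta> \<pi>) (\<lambda>\<omega>. ?c * (1 - ?f \<omega>))" using int by simp
    show "integrable (outcome_space N \<eta> \<pi>) (\<lambda>\<omega>. \<Sum>i<N. selection_prob N k (\<lambda>j. snd (fst \<omega> j)) (snd \<omega>) i * snd (fst \<omega> i))"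
      using selected_value_integrable by (intro Bochner_Integration.integrable_sum) auto
    have "AE \<xi> in distr (outcome_space N \<eta> \<pi>) noises snd. \<forall>j<N. \<xi> j \<in> {1 - \<eta>..1 + \<eta>}"
      unfolding outcome_space_def distr_pair_snd[OF Q.prob_space_axioms noises.prob_space_axioms] by (rule AE_noises)
    then have "AE \<omega> in outcome_space N \<eta> \<pi>. \<forall>j<N. snd \<omega> j \<in> {1 - \<eta>..1 + \<eta>}"
      unfolding outcome_space_def by (rule AE_distrD[OF measurable_snd])
    then show "AE \<omega> in outcome_space N \<eta> \<pi>. ?c * (1 - ?f \<omega>)
      \<le> (\<Sum>i<N. selection_prob N k (\<lambda>j. snd (fst \<omega> j)) (snd \<omega>) i * snd (fst \<omega> i))"
      using AE_space
    proof eventually_elim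
      case (elim \<omega>)
      have "0 \<le> snd (fst \<omega> j)" if "j < N" for j
        using outcome_message_bounds[OF elim(2) that] a by simp
      then show ?case
        using elim(1) by (intro sum_selected_ge_rejection_prob k i \<eta> x) auto
    qed
  qed
  finally show ?thesis .
qed

text \<open>Each value is at most \<open>s\<close> plus its excess over \<open>s\<close>. Extending
  the sum of excesses from \<open>S\<close> to all agents gives a bound that is the same for every
  \<open>S\<close>, hence a bound for the maximum.\<close>

lemma first_best_le:
  assumes "0 \<le> s"
  shows "first_best_welfare N k F \<le> real k * s + (\<Sum>i<N. \<integral>v. max 0 (v - s) \<partial>F i)"
proof -
  have F: "prob_space (F i)" "sets (F i) = sets (value_space a)" "space (F i) = {a..1}" if "i < N" for i
  proof -
    have eq: "distr (\<pi> i) (value_space a) fst = F i" using strategiesD(4)[OF strategy[OF that]] .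
    show sets: "sets (F i) = sets (value_space a)" by (simp add: eq[symmetric])
    show "space (F i) = {a..1}" by (simp add: eq[symmetric])
    have "fst \<in> measurable (\<pi> i) (value_space a)"
      using sets_strategy[OF that] by (simp cong: measurable_cong_sets)
    then show "prob_space (F i)"
      unfolding eq[symmetric] by (rule prob_space.prob_space_distr[OF strategiesD(1)[OF strategy[OF that]]])
  qed
  interpret Q: prob_space "PiM {..<N} F" using F(1) by (intro prob_space_PiM) auto
  have fm: "(\<lambda>v. max 0 (v - s)) \<in> borel_measurable (F i)" if "i < N" for i
  proof -
    have "(\<lambda>v. max 0 (v - s)) \<in> borel_measurable (value_space a)" by measurable
    then show ?thesis using F(2)[OF that] by (simp cong: measurable_cong_sets)
  qed
  have int_i: "integrable (PiM {..<N} F) (\<lambda>v. max 0 (v i - s))" if "i < N" for i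
  proof (rule Q.integrable_const_bound[where B = 1])
    show "AE v in PiM {..<N} F. norm (max 0 (v i - s)) \<le> 1"
    proof (rule AE_I2)
      fix v assume "v \<in> space (PiM {..<N} F)"
      then have "v i \<in> space (F i)" using that by (auto simp: space_PiM PiE_def Pi_def)
      then show "norm (max 0 (v i - s)) \<le> 1" using F(3)[OF that] assms by auto
    qed
    show "(\<lambda>v. max 0 (v i - s)) \<in> borel_measurable (PiM {..<N} F)"
      using measurable_compose[OF measurable_component_singleton[of i "{..<N}" F] fm[OF that]] that by simp
  qed
  have "first_best_welfare N k F \<le> (\<integral>v. real k * s + (\<Sum>i<N. max 0 (v i - s)) \<partial>PiM {..<N} F)"
    unfolding first_best_welfare_def
  proof (rule integral_mono')
    show "integrable (PiM {..<N} F) (\<lambda>v. real k * s + (\<Sum>i<N. max 0 (v i - s)))"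
      using int_i by (intro Bochner_Integration.integrable_add Bochner_Integration.integrable_sum) auto
    fix v :: "nat \<Rightarrow> real"
    have "finite {S. S \<subseteq> {..<N} \<and> card S = k}" by simp
    moreover have "{S. S \<subseteq> {..<N} \<and> card S = k} \<noteq> {}"
      using k(2) obtain_subset_with_card_n[of k "{..<N}"] by auto
    moreover have "(\<Sum>i\<in>S. v i) \<le> real k * s + (\<Sum>i<N. max 0 (v i - s))" if S: "S \<subseteq> {..<N}" "card S = k" for S
    proof -
      have "(\<Sum>i\<in>S. v i) \<le> (\<Sum>i\<in>S. s + max 0 (v i - s))" by (intro sum_mono) auto
      also have "\<dots> = real k * s + (\<Sum>i\<in>S. max 0 (v i - s))" by (simp add: sum.distrib S)
      also have "\<dots> \<le> real k * s + (\<Sum>i<N. max 0 (v i - s))"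
        using S by (intro add_left_mono sum_mono2) auto
      finally show ?thesis .
    qed
    ultimately show "Max (sum v ` {S. S \<subseteq> {..<N} \<and> card S = k}) \<le> real k * s + (\<Sum>i<N. max 0 (v i - s))"
      by (subst Max_le_iff) auto
    show "0 \<le> real k * s + (\<Sum>i<N. max 0 (v i - s))"
      using assms by (intro add_nonneg_nonneg sum_nonneg) auto
  qed
  also have "\<dots> = real k * s + (\<Sum>i<N. \<integral>v. max 0 (v i - s) \<partial>PiM {..<N} F)"
  proof -
    have "integrable (PiM {..<N} F) (\<lambda>v. \<Sum>i<N. max 0 (v i - s))"
      using int_i by (intro Bochner_Integration.integrable_sum) auto
    moreover have "(\<integral>v. (\<Sum>i<N. max 0 (v i - s)) \<partial>PiM {..<N} F) = (\<Sum>i<N. \<integral>v. max 0 (v i - s) \<partial>PiM {..<N} F)"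
      using int_i by (intro Bochner_Integration.integral_sum) auto
    ultimately show ?thesis by (simp add: Q.prob_space)
  qed
  also have "(\<Sum>i<N. \<integral>v. max 0 (v i - s) \<partial>PiM {..<N} F) = (\<Sum>i<N. \<integral>v. max 0 (v - s) \<partial>F i)"
  proof (intro sum.cong refl)
    fix i assume "i \<in> {..<N}"
    then have i: "i < N" by simp
    have "distr (PiM {..<N} F) (F i) (\<lambda>v. v i) = F i"
      using F(1) i by (intro distr_PiM_component) auto
    then have "(\<integral>v. max 0 (v - s) \<partial>F i) = (\<integral>v. max 0 (v - s) \<partial>distr (PiM {..<N} F) (F i) (\<lambda>v. v i))"
      by simp
    also have "\<dots> = (\<integral>v. max 0 (v i - s) \<partial>PiM {..<N} F)"
      using i by (intro integral_distr fm measurable_component_singleton) auto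
    finally show "(\<integral>v. max 0 (v i - s) \<partial>PiM {..<N} F) = (\<integral>v. max 0 (v - s) \<partial>F i)" ..
  qed
  finally show ?thesis .
qed

text \<open>The threshold 1 leaves no excess. This bound serves when the intended message
  \<open>s\<close> exceeds 1.\<close>

lemma first_best_le_k: "first_best_welfare N k F \<le> real k"
proof -
  have "(\<integral>v. max 0 (v - 1) \<partial>F i) = 0" if "i < N" for i
  proof -
    have "space (F i) = {a..1}"
      using strategiesD(4)[OF strategy[OF that], symmetric] by simp
    then have "(\<integral>v. max 0 (v - 1) \<partial>F i) = (\<integral>v. 0 \<partial>F i)"
      by (intro Bochner_Integration.integral_cong) auto
    then show ?thesis by simp
  qed
  then show ?thesis using first_best_le[of 1] by simp
qed

lemma first_best_le_welfare:
  assumes nash: "nash_equilibrium N k a \<eta> F u \<pi>"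
    and u: "\<And>i. i < N \<Longrightarrow> continuous_on {a..1} (u i)" "\<And>i. i < N \<Longrightarrow> mono_on {a..1} (u i)"
      "\<And>i x. i < N \<Longrightarrow> x \<in> {a..1} \<Longrightarrow> 0 < u i x"
  shows "first_best_welfare N k F \<le> 8 * ((1 + \<eta>) / (1 - \<eta>)) * social_welfare N k \<eta> \<pi>"
proof -
  define W where "W = social_welfare N k \<eta> \<pi>"
  define c where "c = (1 + \<eta>) / (1 - \<eta>)"
  define s where "s = 2 * c * W / real k"
  have c: "1 \<le> c" using \<eta> by (simp add: c_def)
  have W: "real k * a \<le> W" using social_welfare_ge by (simp add: W_def)
  have "0 < real k * a" using k a by simp
  then have "0 < W" using W by linarith
  have ks: "real k * s = 2 * c * W" using k by (simp add: s_def)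
  have cW: "W \<le> c * W" using c \<open>0 < W\<close> by simp
  have "real k * a \<le> real k * s" using W cW \<open>0 < W\<close> unfolding ks by linarith
  then have "a \<le> s" using k by simp
  show ?thesis
  \<comment> \<open>The message \<open>s\<close> must be admissible. If it exceeds 1, then
    \<open>k\<close> is below \<open>2 * c * W\<close>, and the trivial bound on the first best
    suffices.\<close>
  proof (cases "s \<le> 1")
    case False
    then have "real k \<le> real k * s" using mult_left_mono[of 1 s "real k"] by simp
    then have "first_best_welfare N k F \<le> 8 * c * W"
      using first_best_le_k ks cW \<open>0 < W\<close> by linarith
    then show ?thesis by (simp only: W_def c_def)
  next
    case True
    have s: "s \<in> {a..1}" "0 < s" using True \<open>a \<le> s\<close> a by auto
    have half: "1 / 2 \<le> win_prob i s" if "i < N" for i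
    proof -
      \<comment> \<open>The factor \<open>c\<close> in \<open>s\<close> cancels the loss from noise;
        the factor 2 leaves a rejection probability of at most one half.\<close>
      have "real k * (s * (1 - \<eta>) / (1 + \<eta>)) = (real k * s) / c"
        using \<eta> by (simp add: c_def)
      also have "\<dots> = 2 * W" unfolding ks using c by simp
      finally have "2 * W * (1 - win_prob i s) \<le> W"
        using rejection_prob_bound[OF that, of s] s by (simp add: W_def)
      then have "W * (1 - 2 * win_prob i s) \<le> 0" by (simp add: algebra_simps)
      then show ?thesis using \<open>0 < W\<close> by (simp add: mult_le_0_iff)
    qed
    have excess: "(\<integral>v. max 0 (v - s) \<partial>F i) \<le> 2 * ((\<integral>x. win_prob i (snd x) * snd x \<partial>\<pi> i) + s * (\<integral>x. win_prob i (snd x) \<partial>\<pi> i))"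
      if i: "i < N" for i
    proof -
      interpret prob_space "\<pi> i" using strategiesD(1)[OF strategy[OF i]] .
      note [measurable_cong] = sets_strategy[OF i]
      note sp = strategiesD(3)[OF strategy[OF i]]
      note r = win_prob_bounds[OF i]
      have [measurable]: "win_prob i \<in> borel_measurable borel"
        using win_prob_mono[OF i] by (rule borel_measurable_mono)
      have rx: "\<bar>win_prob i y * x\<bar> \<le> 1" if "0 \<le> x" "x \<le> 1" for x y
        using r[of y] that mult_mono[of "win_prob i y" 1 x 1] by (simp add: abs_mult)
      have ints: "integrable (\<pi> i) (\<lambda>x. win_prob i (snd x) * snd x)" "integrable (\<pi> i) (\<lambda>x. win_prob i (snd x))"
        "integrable (\<pi> i) (\<lambda>x. win_prob i (snd x) * (if s \<le> snd x then snd x else s))"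
        using sp a s r rx by (auto intro!: integrable_const_bound[where B = 1] AE_I2)
      have opt: "(\<integral>x. win_prob i (snd x) * u i (fst x) \<partial>\<pi>') \<le> (\<integral>x. win_prob i (snd x) * u i (fst x) \<partial>\<pi> i)"
        if "\<pi>' \<in> strategies a (F i)" for \<pi>'
      proof -
        \<comment> \<open>The equilibrium is written as a trivial update so that
          \<open>utility_eq\<close> applies to both sides.\<close>
        have "utility N k \<eta> u (\<pi>(i := \<pi>')) i \<le> utility N k \<eta> u (\<pi>(i := \<pi> i)) i"
          using nash i that by (simp add: nash_equilibrium_def)
        then show ?thesis
          unfolding utility_eq[of i _ u, OF i that u(1)[OF i]] utility_eq[of i _ u, OF i strategy[OF i] u(1)[OF i]] .
      qed
      have nonneg: "0 \<le> (\<integral>v. max 0 (v - s) \<partial>F i)" by simp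
      have "(\<integral>v. max 0 (v - s) \<partial>F i) \<le> 2 * (win_prob i s * (\<integral>v. max 0 (v - s) \<partial>F i))"
        using mult_right_mono[OF half[OF i] nonneg] by simp
      also have "win_prob i s * (\<integral>v. max 0 (v - s) \<partial>F i)
        \<le> (\<integral>x. win_prob i (snd x) * (if s \<le> snd x then snd x else s) \<partial>\<pi> i)"
        using best_response_bound[OF strategy[OF i] a(1) s(1) u(1)[OF i] u(2)[OF i] u(3)[OF i] win_prob_mono[OF i] r opt] .
      \<comment> \<open>The larger of message and \<open>s\<close> is at most their sum; summed over
        the agents, the two terms give \<open>W\<close> and \<open>s * k\<close>.\<close>
      also have "\<dots> \<le> (\<integral>x. win_prob i (snd x) * snd x + s * win_prob i (snd x) \<partial>\<pi> i)"
      proof (rule integral_mono)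
        fix x assume "x \<in> space (\<pi> i)"
        then show "win_prob i (snd x) * (if s \<le> snd x then snd x else s) \<le> win_prob i (snd x) * snd x + s * win_prob i (snd x)"
          using sp a s r[of "snd x"] by auto
      qed (use ints in auto)
      also have "\<dots> = (\<integral>x. win_prob i (snd x) * snd x \<partial>\<pi> i) + s * (\<integral>x. win_prob i (snd x) \<partial>\<pi> i)"
        using ints by simp
      finally show ?thesis by simp
    qed
    have "first_best_welfare N k F \<le> real k * s + (\<Sum>i<N. \<integral>v. max 0 (v - s) \<partial>F i)"
      using s by (intro first_best_le) simp
    also have "\<dots> \<le> real k * s + (\<Sum>i<N. 2 * ((\<integral>x. win_prob i (snd x) * snd x \<partial>\<pi> i) + s * (\<integral>x. win_prob i (snd x) \<partial>\<pi> i)))"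
      using excess by (intro add_left_mono sum_mono) auto
    also have "\<dots> = real k * s + 2 * (W + s * real k)"
      unfolding W_def social_welfare_eq sum_win_prob[symmetric] by (simp add: sum_distrib_left sum.distrib)
    \<comment> \<open>With \<open>k * s = 2 * c * W\<close>, the coefficient 6 is 2 from
      \<open>k * s\<close> and 4 from \<open>2 * s * k\<close>.\<close>
    also have "\<dots> = 2 * W + 6 * (c * W)" using ks by (simp add: mult.commute)
    also have "\<dots> \<le> 8 * c * W" using cW by linarith
    finally show ?thesis by (simp add: W_def c_def)
  qed
qed

end

theorem theoremB5:
  fixes N k :: nat and a \<eta> :: real
    and F :: "nat \<Rightarrow> real measure" and u :: "nat \<Rightarrow> real \<Rightarrow> real"
  assumes "1 \<le> k" and "k \<le> N"
    and "0 < a" and "a < 1"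
    and "0 < \<eta>" and "\<eta> < 1"
    and "\<And>i. i < N \<Longrightarrow> F i \<in> space (prob_algebra (value_space a))"
    and "\<And>i. i < N \<Longrightarrow> continuous_on {a..1} (u i)"
    and "\<And>i. i < N \<Longrightarrow> mono_on {a..1} (u i)"
    and "\<And>i x. i < N \<Longrightarrow> x \<in> {a..1} \<Longrightarrow> 0 < u i x"
  shows "price_of_anarchy N k a \<eta> F u
           \<le> ereal ((11 + 5 * sqrt 5) * ((1 + \<eta>) / (1 - \<eta>))\<^sup>2) \<and>
         (\<forall>\<pi>. nash_equilibrium N k a \<eta> F u \<pi> \<longrightarrow>
            first_best_welfare N k F
              \<le> (11 + 5 * sqrt 5) * ((1 + \<eta>) / (1 - \<eta>))\<^sup>2 * social_welfare N k \<eta> \<pi>)"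
proof -
  define c where "c = (1 + \<eta>) / (1 - \<eta>)"
  define C where "C = (11 + 5 * sqrt 5) * c\<^sup>2"
  have "1 \<le> c" using assms by (simp add: c_def)
  \<comment> \<open>The linear bound \<open>8 * c\<close> implies the stated quadratic one, since
    \<open>c\<close> is at least 1 and 8 is below 11.\<close>
  then have "8 * c \<le> 8 * c\<^sup>2" by (simp add: power2_eq_square)
  also have "\<dots> \<le> C" unfolding C_def by (intro mult_right_mono) (auto intro: add_increasing2)
  finally have C: "8 * c \<le> C" .
  then have "0 < C" using \<open>1 \<le> c\<close> by linarith
  have welfare: "real k * a \<le> social_welfare N k \<eta> \<pi>"
    "first_best_welfare N k F \<le> C * social_welfare N k \<eta> \<pi>"
    if nash: "nash_equilibrium N k a \<eta> F u \<pi>" for \<pi>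
  proof -
    interpret noisy_persuasion N k a \<eta> F \<pi>
      using assms nash by unfold_locales (auto simp: nash_equilibrium_def)
    show pos: "real k * a \<le> social_welfare N k \<eta> \<pi>" by (rule social_welfare_ge)
    have "0 \<le> real k * a" using assms by simp
    then have "0 \<le> social_welfare N k \<eta> \<pi>" using pos by linarith
    have "first_best_welfare N k F \<le> 8 * c * social_welfare N k \<eta> \<pi>"
      unfolding c_def using first_best_le_welfare[OF nash] assms by blast
    also have "\<dots> \<le> C * social_welfare N k \<eta> \<pi>"
      using C \<open>0 \<le> social_welfare N k \<eta> \<pi>\<close> by (rule mult_right_mono)
    finally show "first_best_welfare N k F \<le> C * social_welfare N k \<eta> \<pi>" .
  qed
  define I where "I = (INF \<pi>\<in>{\<pi>. nash_equilibrium N k a \<eta> F u \<pi>}. ereal (social_welfare N k \<eta> \<pi>))"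
  \<comment> \<open>The first bound makes the infimum positive; the second is the welfare inequality
    divided by \<open>C\<close>, which survives the infimum.\<close>
  have I_ge: "ereal (real k * a) \<le> I" "ereal (first_best_welfare N k F / C) \<le> I"
    unfolding I_def using welfare \<open>0 < C\<close> by (auto intro!: INF_greatest simp: field_simps)
  have "0 < real k * a" using assms by simp
  have "ereal (first_best_welfare N k F) / I \<le> ereal C"
  proof (cases I)
    case (real r)
    then have "0 < r" "first_best_welfare N k F \<le> C * r"
      using I_ge \<open>0 < real k * a\<close> \<open>0 < C\<close> by (auto simp: field_simps)
    then show ?thesis using real by (simp add: field_simps)
  next
    \<comment> \<open>This is the case of no equilibrium, where the extended quotient is 0.\<close>
    case PInf
    then show ?thesis using \<open>0 < C\<close> by simp
  next
    case MInf
    then show ?thesis using I_ge by simp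
  qed
  then show ?thesis
    using welfare(2) unfolding price_of_anarchy_def I_def C_def c_def by blast
qed

end
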